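(* Let $\mathcal{A}\subset\mathcal{D}$ be an arbitrary subcollection of the dyadic intervals, and let $Y$ denote the closed linear span of $\{h_I : I\in\mathcal{A}\}$ in $L_1=L_1([0,1])$. Then the quotient Banach space $L_1/Y$ has cotype $2$.
   Context: $L_1=L_1([0,1])$ is the space of (classes of) real-valued Lebesgue integrable functions with norm $\|f\|_{L_1}=\int_0^1|f|\,dt$. The collection of dyadic intervals is $\mathcal{D}=\{[\frac{i-1}{2^n},\frac{i}{2^n}):1\le i\le 2^n,\ n\in\mathbb{N}_0\}$, where $\mathbb{N}_0=\mathbb{N}\cup\{0\}$. For $I\in\mathcal{D}$, $I^+$ denotes the left half of $I$ and $I^-$ its right half (both are again dyadic intervals), and the Haar function is $h_I=\mathbf{1}_{I^+}-\mathbf{1}_{I^-}$. The quotient norm is $\|x+Y\|_{L_1/Y}=\inf_{y\in Y}\|x+y\|_{L_1}$. A Banach space $X$ has cotype $2$ if there is a constant $C<\infty$ such that for every $n\ge1$ and all $x_1,\dots,x_n\in X$, $\bigl(\sum_{j=1}^n\|x_j\|^2\bigr)^{1/2}\le C\,\mathbb{E}_\varepsilon\bigl\|\sum_{j=1}^n\varepsilon_jx_j\bigr\|$, where $\mathbb{E}_\varepsilon$ is the average over all sign vectors $\varepsilon\in\{-1,1\}^n$. *)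

theory Defs
  imports "HOL-Analysis.Analysis"
begin

section \<open>The space $L_1([0,1])$ of classes of integrable functions\<close>

abbreviation unit_interval_measure :: "real measure" where
  "unit_interval_measure \<equiv> lebesgue_on {0..1}"

definition L1_rel :: "(real \<Rightarrow> real) \<Rightarrow> (real \<Rightarrow> real) \<Rightarrow> bool" where
  "L1_rel f g \<longleftrightarrow> integrable unit_interval_measure f \<and> integrable unit_interval_measure g \<and>
     (AE t in unit_interval_measure. f t = g t)"

quotient_type L1 = "real \<Rightarrow> real" / partial: L1_rel
proof (rule part_equivpI)
  show "\<exists>f. L1_rel f f"
    by (rule exI[of _ "\<lambda>_. 0"]) (simp add: L1_rel_def)
  show "symp L1_rel"
    by (auto simp: symp_def L1_rel_def eq_commute)
  show "transp L1_rel"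
    unfolding transp_def L1_rel_def by auto
qed

instantiation L1 :: real_normed_vector
begin

lift_definition zero_L1 :: L1 is "\<lambda>_. 0"
  by (simp add: L1_rel_def)

lift_definition plus_L1 :: "L1 \<Rightarrow> L1 \<Rightarrow> L1" is "\<lambda>f g t. f t + g t"
  unfolding L1_rel_def by auto

lift_definition uminus_L1 :: "L1 \<Rightarrow> L1" is "\<lambda>f t. - f t"
  unfolding L1_rel_def by auto

lift_definition minus_L1 :: "L1 \<Rightarrow> L1 \<Rightarrow> L1" is "\<lambda>f g t. f t - g t"
  unfolding L1_rel_def by auto

lift_definition scaleR_L1 :: "real \<Rightarrow> L1 \<Rightarrow> L1" is "\<lambda>r f t. r * f t"
  unfolding L1_rel_def by auto

lift_definition norm_L1 :: "L1 \<Rightarrow> real" is "\<lambda>f. integral\<^sup>L unit_interval_measure (\<lambda>t. \<bar>f t\<bar>)"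
proof -
  fix f g assume "L1_rel f g"
  then show "integral\<^sup>L unit_interval_measure (\<lambda>t. \<bar>f t\<bar>) = integral\<^sup>L unit_interval_measure (\<lambda>t. \<bar>g t\<bar>)"
    unfolding L1_rel_def by (intro integral_cong_AE) auto
qed

definition sgn_L1 :: "L1 \<Rightarrow> L1" where
  "sgn_L1 x = inverse (norm x) *\<^sub>R x"

definition dist_L1 :: "L1 \<Rightarrow> L1 \<Rightarrow> real" where
  "dist_L1 x y = norm (x - y)"

definition uniformity_L1 :: "(L1 \<times> L1) filter" where
  "uniformity_L1 = (INF e\<in>{0 <..}. principal {(x, y). dist x y < e})"

definition open_L1 :: "L1 set \<Rightarrow> bool" where
  "open_L1 U \<longleftrightarrow> (\<forall>x\<in>U. eventually (\<lambda>(x', y). x' = x \<longrightarrow> y \<in> U) uniformity)"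

instance
proof
  fix x y z :: L1 and a b :: real
  show "x + y + z = x + (y + z)"
    by transfer (auto simp: L1_rel_def algebra_simps)
  show "x + y = y + x"
    by transfer (auto simp: L1_rel_def algebra_simps)
  show "0 + x = x"
    by transfer (auto simp: L1_rel_def)
  show "- x + x = 0"
    by transfer (auto simp: L1_rel_def)
  show "x - y = x + - y"
    by transfer (auto simp: L1_rel_def)
  show "a *\<^sub>R (x + y) = a *\<^sub>R x + a *\<^sub>R y"
    by transfer (auto simp: L1_rel_def algebra_simps)
  show "(a + b) *\<^sub>R x = a *\<^sub>R x + b *\<^sub>R x"
    by transfer (auto simp: L1_rel_def algebra_simps)
  show "a *\<^sub>R b *\<^sub>R x = (a * b) *\<^sub>R x"
    by transfer (auto simp: L1_rel_def algebra_simps)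
  show "1 *\<^sub>R x = x"
    by transfer (auto simp: L1_rel_def)
  show "dist x y = norm (x - y)"
    by (rule dist_L1_def)
  show "sgn x = inverse (norm x) *\<^sub>R x"
    by (rule sgn_L1_def)
  show "(uniformity :: (L1 \<times> L1) filter) = (INF e\<in>{0 <..}. principal {(x, y). dist x y < e})"
    by (rule uniformity_L1_def)
  show "open U \<longleftrightarrow> (\<forall>x\<in>U. eventually (\<lambda>(x', y). x' = x \<longrightarrow> y \<in> U) uniformity)" for U :: "L1 set"
    by (rule open_L1_def)
  show "norm x = 0 \<longleftrightarrow> x = 0"
    by transfer (auto simp: L1_rel_def integral_nonneg_eq_0_iff_AE)
  show "norm (x + y) \<le> norm x + norm y"
  proof transfer
    fix f g assume "L1_rel f f" "L1_rel g g"
    then have i: "integrable unit_interval_measure f" "integrable unit_interval_measure g"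
      by (auto simp: L1_rel_def)
    have "integral\<^sup>L unit_interval_measure (\<lambda>t. \<bar>f t + g t\<bar>)
        \<le> integral\<^sup>L unit_interval_measure (\<lambda>t. \<bar>f t\<bar> + \<bar>g t\<bar>)"
      using i by (intro integral_mono) auto
    also have "\<dots> = integral\<^sup>L unit_interval_measure (\<lambda>t. \<bar>f t\<bar>) + integral\<^sup>L unit_interval_measure (\<lambda>t. \<bar>g t\<bar>)"
      using i by simp
    finally show "integral\<^sup>L unit_interval_measure (\<lambda>t. \<bar>f t + g t\<bar>)
        \<le> integral\<^sup>L unit_interval_measure (\<lambda>t. \<bar>f t\<bar>) + integral\<^sup>L unit_interval_measure (\<lambda>t. \<bar>g t\<bar>)" .
  qed
  show "norm (a *\<^sub>R x) = \<bar>a\<bar> * norm x"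
    by transfer (simp add: abs_mult)
qed

end

section \<open>The Haar system\<close>

definition dyadic_intervals :: "real set set" where
  "dyadic_intervals = {{(real i - 1) / 2 ^ n ..< real i / 2 ^ n} | i n. 1 \<le> i \<and> i \<le> (2::nat) ^ n}"

definition left_half :: "real set \<Rightarrow> real set" where
  "left_half I = {Inf I ..< (Inf I + Sup I) / 2}"

definition right_half :: "real set \<Rightarrow> real set" where
  "right_half I = {(Inf I + Sup I) / 2 ..< Sup I}"

definition haar :: "real set \<Rightarrow> real \<Rightarrow> real" where
  "haar I t = indicator (left_half I) t - indicator (right_half I) t"

lemma halves_of_interval:
  assumes "a < b"
  shows "left_half {a..<b} = {a ..< (a + b) / 2}" and "right_half {a..<b} = {(a + b) / 2 ..< b}"
  using assms by (simp_all add: left_half_def right_half_def)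

lemma integrable_haar: "integrable unit_interval_measure (haar I)"
proof -
  have "integrable unit_interval_measure (indicator {a..<b} :: real \<Rightarrow> real)" for a b :: real
  proof (rule Bochner_Integration.integrable_bound)
    show "integrable unit_interval_measure (\<lambda>_. 1 :: real)"
      by simp
    have "indicator {a..<b} \<in> borel_measurable lebesgue"
      by (rule borel_measurable_indicator) simp
    then show "(indicator {a..<b} :: real \<Rightarrow> real) \<in> borel_measurable unit_interval_measure"
      by (rule measurable_restrict_space1)
  qed (auto simp: indicator_def)
  then show ?thesis
    unfolding haar_def left_half_def right_half_def by (intro Bochner_Integration.integrable_diff) auto
qed

lift_definition haar_L1 :: "real set \<Rightarrow> L1" is haar
  by (simp add: L1_rel_def integrable_haar)

section \<open>Normed spaces on a carrier, and quotients\<close>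

text \<open>
  The quotient by a subspace Y depends on the term Y and so cannot be a type. Normed spaces are
  therefore also represented by records with an explicit carrier.
\<close>

record 'v nspace =
  nscarrier :: "'v set"
  nszero :: 'v
  nsadd :: "'v \<Rightarrow> 'v \<Rightarrow> 'v"
  nsscale :: "real \<Rightarrow> 'v \<Rightarrow> 'v"
  nsnorm :: "'v \<Rightarrow> real"

locale normed_space =
  fixes X :: "('v, 'm) nspace_scheme"
  assumes zero_closed: "nszero X \<in> nscarrier X"
    and add_closed: "x \<in> nscarrier X \<Longrightarrow> y \<in> nscarrier X \<Longrightarrow> nsadd X x y \<in> nscarrier X"
    and scale_closed: "x \<in> nscarrier X \<Longrightarrow> nsscale X a x \<in> nscarrier X"
    and add_assoc: "\<lbrakk>x \<in> nscarrier X; y \<in> nscarrier X; z \<in> nscarrier X\<rbrakk> \<Longrightarrow>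
          nsadd X (nsadd X x y) z = nsadd X x (nsadd X y z)"
    and add_commute: "x \<in> nscarrier X \<Longrightarrow> y \<in> nscarrier X \<Longrightarrow> nsadd X x y = nsadd X y x"
    and add_zero: "x \<in> nscarrier X \<Longrightarrow> nsadd X (nszero X) x = x"
    and add_minus: "x \<in> nscarrier X \<Longrightarrow> nsadd X (nsscale X (- 1) x) x = nszero X"
    and scale_add: "x \<in> nscarrier X \<Longrightarrow> y \<in> nscarrier X \<Longrightarrow>
          nsscale X a (nsadd X x y) = nsadd X (nsscale X a x) (nsscale X a y)"
    and add_scale: "x \<in> nscarrier X \<Longrightarrow> nsscale X (a + b) x = nsadd X (nsscale X a x) (nsscale X b x)"
    and scale_scale: "x \<in> nscarrier X \<Longrightarrow> nsscale X a (nsscale X b x) = nsscale X (a * b) x"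
    and scale_one: "x \<in> nscarrier X \<Longrightarrow> nsscale X 1 x = x"
    and norm_eq_0: "x \<in> nscarrier X \<Longrightarrow> nsnorm X x = 0 \<longleftrightarrow> x = nszero X"
    and norm_triangle: "x \<in> nscarrier X \<Longrightarrow> y \<in> nscarrier X \<Longrightarrow>
          nsnorm X (nsadd X x y) \<le> nsnorm X x + nsnorm X y"
    and norm_scale: "x \<in> nscarrier X \<Longrightarrow> nsnorm X (nsscale X a x) = \<bar>a\<bar> * nsnorm X x"

text \<open>
  Elements of the quotient are the cosets \<open>x +o Y\<close>, and \<open>+\<close> on them is the Minkowski sum. The summand
  Y in the scaling only matters for the factor 0, where it gives the zero coset Y instead of the
  singleton of 0. As a coset is the set of all \<open>x + y\<close> with \<open>y \<in> Y\<close>, its quotient norm is the infimum of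
  the norms of its elements.
\<close>

definition quotient_space :: "'a::real_normed_vector set \<Rightarrow> 'a set nspace" where
  "quotient_space Y =
    \<lparr> nscarrier = range (\<lambda>x. x +o Y),
      nszero = Y,
      nsadd = (\<lambda>Q R. Q + R),
      nsscale = (\<lambda>a Q. (\<lambda>x. a *\<^sub>R x) ` Q + Y),
      nsnorm = (\<lambda>Q. INF z\<in>Q. norm z) \<rparr>"

lemma quotient_space_ops:
  assumes "subspace Y"
  shows "nsadd (quotient_space Y) (x +o Y) (y +o Y) = (x + y) +o Y"
    and "nsscale (quotient_space Y) a (x +o Y) = (a *\<^sub>R x) +o Y"
    and "nsnorm (quotient_space Y) (x +o Y) = (INF y\<in>Y. norm (x + y))"
proof -
  show "nsadd (quotient_space Y) (x +o Y) (y +o Y) = (x + y) +o Y"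
  proof (intro set_eqI iffI)
    fix c assume "c \<in> nsadd (quotient_space Y) (x +o Y) (y +o Y)"
    then obtain u v where "u \<in> Y" "v \<in> Y" "c = (x + u) + (y + v)"
      by (auto simp: quotient_space_def set_plus_def elt_set_plus_def)
    then show "c \<in> (x + y) +o Y"
      using subspace_add[OF assms] by (auto simp: elt_set_plus_def algebra_simps intro!: bexI[of _ "u + v"])
  next
    fix c assume "c \<in> (x + y) +o Y"
    then obtain u where "u \<in> Y" "c = (x + u) + (y + 0)"
      by (auto simp: elt_set_plus_def algebra_simps)
    then show "c \<in> nsadd (quotient_space Y) (x +o Y) (y +o Y)"
      using subspace_0[OF assms]
      unfolding quotient_space_def set_plus_def elt_set_plus_def nspace.simps by blast
  qed
  show "nsscale (quotient_space Y) a (x +o Y) = (a *\<^sub>R x) +o Y"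
  proof (intro set_eqI iffI)
    fix c assume "c \<in> nsscale (quotient_space Y) a (x +o Y)"
    then obtain u v where "u \<in> Y" "v \<in> Y" "c = a *\<^sub>R (x + u) + v"
      by (auto simp: quotient_space_def set_plus_def elt_set_plus_def)
    then show "c \<in> (a *\<^sub>R x) +o Y"
      using subspace_add[OF assms subspace_scale[OF assms]]
      by (auto simp: elt_set_plus_def algebra_simps intro!: bexI[of _ "a *\<^sub>R u + v"])
  next
    fix c assume "c \<in> (a *\<^sub>R x) +o Y"
    then obtain u where "u \<in> Y" "c = a *\<^sub>R (x + 0) + u"
      by (auto simp: elt_set_plus_def algebra_simps)
    then show "c \<in> nsscale (quotient_space Y) a (x +o Y)"
      using subspace_0[OF assms]
      unfolding quotient_space_def set_plus_def elt_set_plus_def nspace.simps by blast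
  qed
  have "x +o Y = (\<lambda>y. x + y) ` Y"
    by (auto simp: elt_set_plus_def)
  then show "nsnorm (quotient_space Y) (x +o Y) = (INF y\<in>Y. norm (x + y))"
    by (simp add: quotient_space_def image_image)
qed

lemma normed_space_quotient:
  fixes Y :: "'a::real_normed_vector set"
  assumes Y: "subspace Y" and "closed Y"
  shows "normed_space (quotient_space Y)"
proof -
  note ops = quotient_space_ops(1,2)[OF Y]
  define N where "N x = (INF y\<in>Y. norm (x + y))" for x
  have norm_eq: "nsnorm (quotient_space Y) (x +o Y) = N x" for x
    unfolding N_def by (rule quotient_space_ops(3)[OF Y])
  have Y_ne: "Y \<noteq> {}"
    using subspace_0[OF Y] by auto
  have bdd: "bdd_below ((\<lambda>y. norm (x + y)) ` Y)" for x
    by (rule bdd_belowI[of _ 0]) auto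
  have N_le: "N x \<le> norm (x + y)" if "y \<in> Y" for x y
    unfolding N_def using bdd that by (rule cINF_lower)
  have N_nonneg: "0 \<le> N x" for x
    unfolding N_def using Y_ne by (intro cINF_greatest) auto
  have N_approx: "\<exists>y\<in>Y. norm (x + y) < N x + e" if "e > 0" for x e
  proof (rule ccontr)
    assume "\<not> ?thesis"
    then have "N x + e \<le> N x"
      unfolding N_def[of x, symmetric] by (subst (2) N_def, intro cINF_greatest[OF Y_ne]) (auto simp: not_less)
    then show False using that by simp
  qed
  have coset_mem: "x +o Y = Y \<longleftrightarrow> x \<in> Y" for x
  proof
    assume "x +o Y = Y"
    then show "x \<in> Y"
      using subspace_0[OF Y] unfolding elt_set_plus_def by force
  next
    assume "x \<in> Y"
    then show "x +o Y = Y"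
      using subspace_add[OF Y \<open>x \<in> Y\<close>] subspace_diff[OF Y _ \<open>x \<in> Y\<close>]
      by (auto simp: elt_set_plus_def intro!: bexI[of _ "_ - x"])
  qed
  have N_0: "N x = 0 \<longleftrightarrow> x \<in> Y" for x
  proof
    assume "N x = 0"
    have "x \<in> closure Y"
      unfolding closure_approachable
    proof (intro allI impI)
      fix e :: real assume "0 < e"
      then obtain y where "y \<in> Y" "norm (x + y) < e"
        using N_approx[of e x] \<open>N x = 0\<close> by auto
      then show "\<exists>z\<in>Y. dist z x < e"
        using subspace_neg[OF Y]
        by (intro bexI[of _ "- y"]) (auto simp: dist_norm norm_minus_commute[of "- y"])
    qed
    then show "x \<in> Y" using \<open>closed Y\<close> by simp
  next
    assume "x \<in> Y"
    then show "N x = 0"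
      using N_le[OF subspace_neg[OF Y], of x x] N_nonneg[of x] by simp
  qed
  have N_triangle: "N (x + y) \<le> N x + N y" for x y
  proof (rule field_le_epsilon)
    fix e :: real assume "0 < e"
    then obtain u v where "u \<in> Y" "norm (x + u) < N x + e / 2" "v \<in> Y" "norm (y + v) < N y + e / 2"
      using N_approx[of "e / 2"] by (metis half_gt_zero)
    moreover have "norm ((x + y) + (u + v)) \<le> norm (x + u) + norm (y + v)"
      using norm_triangle_ineq[of "x + u" "y + v"] by (simp add: algebra_simps)
    ultimately show "N (x + y) \<le> N x + N y + e"
      using N_le[OF subspace_add[OF Y], of u v "x + y"] by simp
  qed
  have N_scale_le: "N (a *\<^sub>R x) \<le> \<bar>a\<bar> * N x" if "a \<noteq> 0" for a x
  proof (rule field_le_epsilon)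
    fix e :: real assume "0 < e"
    then obtain y where y: "y \<in> Y" "norm (x + y) < N x + e / \<bar>a\<bar>"
      using N_approx[of "e / \<bar>a\<bar>" x] \<open>a \<noteq> 0\<close> by auto
    have "N (a *\<^sub>R x) \<le> norm (a *\<^sub>R x + a *\<^sub>R y)"
      by (intro N_le subspace_scale[OF Y] y)
    also have "\<dots> = \<bar>a\<bar> * norm (x + y)"
      by (simp flip: scaleR_add_right)
    also have "\<dots> \<le> \<bar>a\<bar> * (N x + e / \<bar>a\<bar>)"
      using y by (intro mult_left_mono) auto
    finally show "N (a *\<^sub>R x) \<le> \<bar>a\<bar> * N x + e"
      using \<open>a \<noteq> 0\<close> by (simp add: distrib_left)
  qed
  have N_scale: "N (a *\<^sub>R x) = \<bar>a\<bar> * N x" for a x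
  proof (cases "a = 0")
    case True
    then show ?thesis using N_0[of 0] subspace_0[OF Y] by simp
  next
    case False
    then have "\<bar>a\<bar> * N x \<le> N (a *\<^sub>R x)"
      using N_scale_le[of "inverse a" "a *\<^sub>R x"] by (simp add: field_simps)
    with N_scale_le[OF False, of x] show ?thesis by simp
  qed
  have carrier: "nscarrier (quotient_space Y) = range (\<lambda>x. x +o Y)"
    by (simp add: quotient_space_def)
  have zero: "nszero (quotient_space Y) = Y"
    by (simp add: quotient_space_def)
  have zero_mem: "Y \<in> range (\<lambda>x. x +o Y)"
    by (rule range_eqI[of _ _ 0]) simp
  have zero_add: "nsadd (quotient_space Y) Y (x +o Y) = x +o Y" for x
    using ops(1)[of 0 x] by simp
  show ?thesis
    by (unfold_locales; unfold carrier zero; (elim rangeE)?;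
        simp add: zero_mem zero_add ops norm_eq N_0 N_triangle N_scale algebra_simps coset_mem
          subspace_0[OF Y])
qed

section \<open>Cotype 2\<close>

primrec nssum :: "('v, 'm) nspace_scheme \<Rightarrow> (nat \<Rightarrow> 'v) \<Rightarrow> nat \<Rightarrow> 'v" where
  "nssum X x 0 = nszero X"
| "nssum X x (Suc n) = nsadd X (nssum X x n) (x n)"

definition sign_vectors :: "nat \<Rightarrow> (nat \<Rightarrow> real) set" where
  "sign_vectors n = {..<n} \<rightarrow>\<^sub>E {-1, 1}"

definition cotype_2 :: "('v, 'm) nspace_scheme \<Rightarrow> bool" where
  "cotype_2 X \<longleftrightarrow>
    (\<exists>C::real. \<forall>n\<ge>1. \<forall>x. (\<forall>j<n. x j \<in> nscarrier X) \<longrightarrow>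
       sqrt (\<Sum>j<n. (nsnorm X (x j))\<^sup>2) \<le>
         C * ((\<Sum>\<epsilon>\<in>sign_vectors n. nsnorm X (nssum X (\<lambda>j. nsscale X (\<epsilon> j) (x j)) n))
                / real (card (sign_vectors n))))"

end

theory Submission
  imports Defs
begin

text \<open>
  After approximation, everything happens among dyadic step functions of one level \<open>m\<close>.
  Among all lifts of \<open>(x\<^sub>j)\<close> take the minimiser \<open>f\<close> of the smoothed \<open>L\<^sub>1(\<ell>\<^sub>2)\<close> norm, \<open>\<integral> w\<close> with
  \<open>w = sqrt (\<parallel>f\<parallel>\<^sup>2 + \<eta>\<^sup>2)\<close>. Stationarity says that \<open>u = f / w\<close>, which has values in the unit ball of
  \<open>\<ell>\<^sub>2\<close>, is orthogonal to the Haar functions in \<open>\<A>\<close>: as a dyadic martingale it does not move at the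
  nodes of \<open>\<A>\<close>. For a sign vector put \<open>U = \<Sum>\<^sub>j \<epsilon>\<^sub>j u\<^sub>j\<close>, so that \<open>\<Sum>\<^sub>j \<epsilon>\<^sub>j f\<^sub>j = w U\<close>. A Bellman function
  bounds the scalar quotient norm of \<open>w U\<close> from below by \<open>\<integral> w U\<^sup>2\<close> minus a defect of fourth order in
  \<open>U\<close>; replacing \<open>U\<close> by \<open>U / \<lambda>\<close> with \<open>\<lambda>\<close> large makes the defect negligible. Averaged over the signs,
  the main term is \<open>\<integral> w \<parallel>u\<parallel>\<^sup>2 \<approx> \<integral> w\<close> and the defect is \<open>O(\<integral> w)\<close>, so \<open>\<integral> w\<close>, and with it
  \<open>(\<Sum>\<^sub>j \<parallel>x\<^sub>j\<parallel>\<^sup>2)\<^sup>1\<^sup>/\<^sup>2\<close>, is at most a constant times the Rademacher average.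
\<close>

text \<open>If \<open>U\<close> were bounded by 1, duality would finish at once: \<open>U\<close>
  annihilates every Haar sum \<open>y\<close> over \<A>, so the integral of \<open>w U^2\<close>
  equals that of \<open>U (w U + y)\<close>, which is at most the norm of \<open>w U + y\<close>.
  But a bound on the l2 norm of \<open>u\<close> controls only the moments of \<open>U\<close> over
  the signs, not its size, and truncating \<open>U\<close> would destroy its orthogonality to the
  Haar functions in \<A>. The Bellman function keeps the pairing while \<open>U\<close> is small and
  gives it up elsewhere at a controlled price. This price falls due at every node off \<A>, so it
  must not accumulate with the depth of the tree. It is built from squared increments of
  \<open>u\<close> and of the square root of the weight, and a potential that telescopes along the
  tree pays for these; fourth moments of the signs are all that the averaging needs. One lift
  \<open>f\<close> serves all signs, whereas the best lift of the signed sum depends on them. Their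
  difference is a Haar sum over \<A>, which is the \<open>y\<close> above. The smoothing \<eta>
  keeps \<open>w\<close> positive, so that \<open>f / w\<close> makes sense.\<close>

section \<open>The Bellman function\<close>

text \<open>
  Here \<open>z\<close> is a local size of the weight, \<open>U\<close> the current value of the martingale and \<open>y\<close> the offset
  contributed so far by Haar functions in \<open>\<A>\<close>. The term \<open>U * y\<close> is the pairing with \<open>U\<close> itself; for
  large \<open>\<bar>y\<bar>\<close> it must be cut off at slope 1, and \<open>\<bar>y\<bar> - 3 * sqrt (z * \<bar>y\<bar>)\<close> does so without loss
  because it is affine in \<open>sqrt z\<close>. The constants only have to make each of the three branches
  dominant where another one becomes unavailable.
\<close>
definition bellman :: "real \<Rightarrow> real \<Rightarrow> real \<Rightarrow> real" where
  "bellman z U y = max (- (3/10) * z)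
     (max (if \<bar>U\<bar> \<le> 1/50 then U * y - 10000000 * U^4 * z else - (3/10) * z)
          (if 4 * z \<le> \<bar>y\<bar> then \<bar>y\<bar> - 3 * sqrt (z * \<bar>y\<bar>) else - (3/10) * z))"

lemma bellman_ge_floor: "- (3/10) * z \<le> bellman z U y"
  by (simp add: bellman_def)

lemma bellman_ge_linear: "\<bar>U\<bar> \<le> 1/50 \<Longrightarrow> U * y - 10000000 * U^4 * z \<le> bellman z U y"
  by (simp add: bellman_def)

lemma bellman_ge_root: "4 * z \<le> \<bar>y\<bar> \<Longrightarrow> \<bar>y\<bar> - 3 * sqrt (z * \<bar>y\<bar>) \<le> bellman z U y"
  by (simp add: bellman_def)

text \<open>With \<open>p\<close>, \<open>q\<close> the roots of \<open>z\<close> and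
  \<open>\<bar>y\<bar>\<close>, the inequality \<open>(q - p) * (q - 2 * p) \<le> 0\<close> puts the
  root expression below \<open>- 2 * z\<close> on the gap from \<open>z\<close> to
  \<open>4 * z\<close>, hence below the floor. The bound is therefore usable from \<open>z\<close>
  on, without regard to the cutoff.\<close>

lemma bellman_ge_root':
  assumes "0 < z" "z \<le> \<bar>y\<bar>"
  shows "\<bar>y\<bar> - 3 * sqrt (z * \<bar>y\<bar>) \<le> bellman z U y"
proof (cases "4 * z \<le> \<bar>y\<bar>")
  case True then show ?thesis by (rule bellman_ge_root)
next
  case False
  define p q where "p = sqrt z" and "q = sqrt \<bar>y\<bar>"
  have pq: "z = p\<^sup>2" "\<bar>y\<bar> = q\<^sup>2" "0 < p" "0 < q"
    using assms by (auto simp: p_def q_def)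
  have "p \<le> q" using assms unfolding p_def q_def by simp
  have "q \<le> 2 * p"
    using False unfolding pq by (smt (verit) pq(3) power2_less_imp_less power_mult_distrib zero_le_mult_iff
      four_x_squared)
  have "sqrt (z * \<bar>y\<bar>) = p * q"
    unfolding p_def q_def by (simp add: real_sqrt_mult)
  moreover have "(q - p) * (q - 2 * p) \<le> 0"
    using \<open>p \<le> q\<close> \<open>q \<le> 2 * p\<close> by (intro mult_nonneg_nonpos) auto
  ultimately have "\<bar>y\<bar> - 3 * sqrt (z * \<bar>y\<bar>) \<le> - 2 * z"
    unfolding pq(1,2) by (simp add: algebra_simps power2_eq_square)
  with bellman_ge_floor[of z U y] assms show ?thesis by linarith
qed

lemma bellman_le:
  assumes "- (3/10) * z \<le> L"
    and "\<bar>U\<bar> \<le> 1/50 \<Longrightarrow> U * y - 10000000 * U^4 * z \<le> L"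
    and "4 * z \<le> \<bar>y\<bar> \<Longrightarrow> \<bar>y\<bar> - 3 * sqrt (z * \<bar>y\<bar>) \<le> L"
  shows "bellman z U y \<le> L"
  using assms by (auto simp: bellman_def)

text \<open>Each branch has its own reason. Floor: \<open>U^2\<close> is paid by 3/10 when small and
  by \<open>U^4\<close> when large. Linear: pairing with \<open>U\<close>, as
  \<open>\<bar>U\<bar> \<le> 1\<close>. Root:
  \<open>3 * sqrt (w * \<bar>s\<bar>) \<ge> 6 * w\<close> pays for
  \<open>w * \<bar>U\<bar> + w * U^2\<close>.\<close>

lemma bellman_leaf:
  assumes "0 < w"
  shows "w * U^2 + bellman w U s \<le> \<bar>w * U + s\<bar> + 2000000000 * w * U^4"
proof -
  have sq: "U^2 \<le> 2000000000 * U^4 + 3/10"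
  proof -
    have "0 \<le> (U^2 * 10000 - 1)^2" by simp
    then have "20000 * U^2 \<le> 100000000 * U^4 + 1" by (simp add: power2_eq_square algebra_simps power4_eq_xxxx)
    moreover have "Q \<le> 2000000000 * P + 3/10" if "20000 * Q \<le> 100000000 * P + 1" "0 \<le> P" for P Q :: real
      using that by simp
    moreover have "0 \<le> U^4" by simp
    ultimately show ?thesis by blast
  qed
  have "bellman w U s \<le> \<bar>w * U + s\<bar> + 2000000000 * w * U^4 - w * U^2"
  proof (rule bellman_le)
    have "w * U^2 \<le> w * (2000000000 * U^4 + 3/10)" using sq assms by (intro mult_left_mono) auto
    then show "- (3/10) * w \<le> \<bar>w * U + s\<bar> + 2000000000 * w * U^4 - w * U^2" by (simp add: algebra_simps)
  next
    assume "\<bar>U\<bar> \<le> 1/50"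
    have "U * (w * U + s) \<le> \<bar>U\<bar> * \<bar>w * U + s\<bar>" by (metis abs_ge_self abs_mult)
    also have "\<dots> \<le> 1 * \<bar>w * U + s\<bar>" using \<open>\<bar>U\<bar> \<le> 1/50\<close> by (intro mult_right_mono) auto
    finally have "U * s \<le> \<bar>w * U + s\<bar> - w * U^2" by (simp add: algebra_simps power2_eq_square)
    moreover have "0 \<le> w * U^4" using assms by simp
    ultimately show "U * s - 10000000 * U^4 * w \<le> \<bar>w * U + s\<bar> + 2000000000 * w * U^4 - w * U^2"
      by (simp add: algebra_simps)
  next
    assume s: "4 * w \<le> \<bar>s\<bar>"
    have "\<bar>s\<bar> \<le> \<bar>w * U + s\<bar> + w * \<bar>U\<bar>" using assms abs_mult[of w U] by linarith
    moreover have "6 * w \<le> 3 * sqrt (w * \<bar>s\<bar>)"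
    proof -
      have "2 * w = sqrt ((2 * w)^2)" using assms by (intro real_sqrt_unique[symmetric]) auto
      also have "\<dots> \<le> sqrt (w * \<bar>s\<bar>)"
        using mult_left_mono[OF s, of w] assms by (intro real_sqrt_le_mono) (auto simp: power2_eq_square)
      finally show ?thesis by simp
    qed
    moreover have "w * (\<bar>U\<bar> + U^2) \<le> w * (6 + 2000000000 * U^4)"
    proof (intro mult_left_mono)
      have "0 \<le> (\<bar>U\<bar> - 1)^2" by simp
      then have "\<bar>U\<bar> \<le> U^2 + 1" by (simp add: power2_eq_square algebra_simps)
      moreover have "0 \<le> U^4" by simp
      ultimately show "\<bar>U\<bar> + U^2 \<le> 6 + 2000000000 * U^4" using sq
      proof -
        have "0 \<le> (U^2 - 1)^2" by simp
        then have "2 * U^2 \<le> U^4 + 1" by (simp add: power2_eq_square algebra_simps power4_eq_xxxx)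
        then show ?thesis using \<open>\<bar>U\<bar> \<le> U^2 + 1\<close> \<open>0 \<le> U^4\<close> by linarith
      qed
    qed (use assms in auto)
    ultimately show "\<bar>s\<bar> - 3 * sqrt (w * \<bar>s\<bar>) \<le> \<bar>w * U + s\<bar> + 2000000000 * w * U^4 - w * U^2"
      by (simp add: algebra_simps)
  qed
  then show ?thesis by simp
qed

text \<open>The value at the top of the tree, where no offset has accumulated. Beyond 1/50 the
  linear branch is off, but there the quartic term exceeds the floor.\<close>

lemma bellman_zero: assumes "0 < z" shows "- 2000000000 * z * U^4 \<le> bellman z U 0"
proof (cases "\<bar>U\<bar> \<le> 1/50")
  case True
  have "0 \<le> z * U^4" using assms by simp
  with bellman_ge_linear[OF True, of 0 z] show ?thesis by (simp add: algebra_simps)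
next
  case False
  then have "(1/50)^4 \<le> \<bar>U\<bar>^4" by (intro power_mono) auto
  then have "3/10 \<le> 2000000000 * U^4" by (simp add: power_divide)
  then have "z * (3/10) \<le> z * (2000000000 * U^4)" using assms by (intro mult_left_mono) auto
  with bellman_ge_floor[of z U 0] show ?thesis by (simp add: algebra_simps)
qed

text \<open>For a fixed \<open>U\<close> the function is the perspective of a convex function of \<open>y / z\<close>.\<close>
lemma bellman_convex:
  assumes "0 < a" "0 < b"
  shows "bellman ((a + b) / 2) U ((y1 + y2) / 2) \<le> (bellman a U y1 + bellman b U y2) / 2"
proof (rule bellman_le)
  show "- (3/10) * ((a + b) / 2) \<le> (bellman a U y1 + bellman b U y2) / 2"
    using bellman_ge_floor[of a U y1] bellman_ge_floor[of b U y2] by argo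
next
  assume "\<bar>U\<bar> \<le> 1/50"
  from bellman_ge_linear[OF this, of y1 a] bellman_ge_linear[OF this, of y2 b]
  show "U * ((y1 + y2) / 2) - 10000000 * U^4 * ((a + b) / 2) \<le> (bellman a U y1 + bellman b U y2) / 2"
    by (simp add: field_simps)
next
  define z y where "z = (a + b) / 2" and "y = \<bar>(y1 + y2) / 2\<bar>"
  assume "4 * ((a + b) / 2) \<le> \<bar>(y1 + y2) / 2\<bar>"
  then have y: "4 * z \<le> y" by (simp add: z_def y_def)
  have z: "0 < z" using assms by (simp add: z_def)
  define p q where "p = sqrt z" and "q = sqrt y"
  have "0 < y" using y z by linarith
  have pq: "z = p\<^sup>2" "y = q\<^sup>2" "0 < p" "0 < q" "2 * p \<le> q"
    using y z \<open>0 < y\<close> real_sqrt_le_mono[OF y] by (auto simp: p_def q_def real_sqrt_mult)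
  \<comment> \<open>The tangent plane of \<open>y - 3 * sqrt (z * y)\<close> at
    \<open>(z, y)\<close>; this function is convex and homogeneous of degree one, so there is no
    constant term. The plane stays below \<open>bellman\<close>: for
    \<open>c \<le> \<bar>x\<bar>\<close> by AM-GM, and for \<open>\<bar>x\<bar> < c\<close> because
    \<open>r \<le> 1/2\<close> pushes it below \<open>- 2 * c\<close>.\<close>
  have key: "(1 - 3 * p / (2 * q)) * (\<sigma> * x) - 3 * q / (2 * p) * c \<le> bellman c U x"
    if c: "0 < c" and \<sigma>: "\<sigma> = 1 \<or> \<sigma> = -1" for c x \<sigma>
  proof -
    define r where "r = p / q"
    have r: "0 < r" "r \<le> 1/2" using pq by (auto simp: r_def field_simps)
    have eq: "(1 - 3 * p / (2 * q)) * (\<sigma> * x) - 3 * q / (2 * p) * c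
        = (1 - 3 / 2 * r) * (\<sigma> * x) - 3 / 2 / r * c"
      by (simp add: r_def)
    have le: "(1 - 3 / 2 * r) * (\<sigma> * x) \<le> (1 - 3 / 2 * r) * \<bar>x\<bar>"
      using r \<sigma> by (intro mult_left_mono) auto
    show ?thesis
    proof (cases "c \<le> \<bar>x\<bar>")
      case True
      have "0 < \<bar>x\<bar>" using True c by linarith
      define e f where "e = sqrt c" and "f = sqrt \<bar>x\<bar>"
      have ef: "c = e\<^sup>2" "\<bar>x\<bar> = f\<^sup>2" "sqrt (c * \<bar>x\<bar>) = e * f"
        using c by (auto simp: e_def f_def real_sqrt_mult)
      have "0 \<le> (e - r * f)\<^sup>2 / r" using r by simp
      then have "2 * e * f \<le> e\<^sup>2 / r + r * f\<^sup>2"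
        using r by (simp add: field_simps power2_eq_square)
      then have "(1 - 3 / 2 * r) * \<bar>x\<bar> - 3 / 2 / r * c \<le> \<bar>x\<bar> - 3 * sqrt (c * \<bar>x\<bar>)"
        unfolding ef(3) unfolding ef(1,2) by (simp add: algebra_simps)
      with bellman_ge_root'[OF c True, of U] le eq show ?thesis by linarith
    next
      case False
      have "(1 - 3 / 2 * r) * \<bar>x\<bar> \<le> 1 * c" using False r by (intro mult_mono) auto
      moreover have "3 * c \<le> 3 / 2 / r * c" using r c by (intro mult_right_mono) (auto simp: field_simps)
      ultimately show ?thesis using le eq bellman_ge_floor[of c U x] c by linarith
    qed
  qed
  \<comment> \<open>The sign of the averaged offset makes the absolute value linear in
    \<open>y1\<close> and \<open>y2\<close>, so the two tangent bounds can be averaged.\<close>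
  obtain \<sigma> :: real where \<sigma>: "\<sigma> = 1 \<or> \<sigma> = -1" "y = \<sigma> * ((y1 + y2) / 2)"
    unfolding y_def by (metis abs_if mult_1 mult_minus1)
  have "y - 3 * sqrt (z * y) = (1 - 3 * p / (2 * q)) * y - 3 * q / (2 * p) * z"
    using pq unfolding p_def[symmetric] q_def[symmetric] real_sqrt_mult
    by (simp add: field_simps power2_eq_square)
  also have "\<dots> = (((1 - 3 * p / (2 * q)) * (\<sigma> * y1) - 3 * q / (2 * p) * a)
      + ((1 - 3 * p / (2 * q)) * (\<sigma> * y2) - 3 * q / (2 * p) * b)) / 2"
    unfolding \<sigma>(2) z_def by argo
  also have "\<dots> \<le> (bellman a U y1 + bellman b U y2) / 2"
    using key[OF assms(1) \<sigma>(1), of y1] key[OF assms(2) \<sigma>(1), of y2]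
    by (intro divide_right_mono add_mono) auto
  finally show "\<bar>(y1 + y2) / 2\<bar> - 3 * sqrt ((a + b) / 2 * \<bar>(y1 + y2) / 2\<bar>) \<le> (bellman a U y1 + bellman b U y2) / 2"
    by (simp add: z_def y_def)
qed

text \<open>The dangerous terms are the ones of first order in \<open>g\<close>, such as
  \<open>v * g * U^3 * d\<close>. Grouped as \<open>(g * U^2) * (v * (U * d))\<close> they are
  bounded by squares that already occur in the error.\<close>

lemma quartic_split_bound:
  fixes \<alpha> \<beta> U d :: real
  assumes "0 < \<alpha>" "0 < \<beta>"
  shows "(\<alpha>^2 * (U + d)^4 + \<beta>^2 * (U - d)^4) / 2
    \<le> ((\<alpha> + \<beta>) / 2)^2 * U^4 + 20 * (((\<alpha> - \<beta>) / 2)^2 * U^4 + ((\<alpha> + \<beta>) / 2)^2 * (U^2 * d^2 + d^4))"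
proof -
  define v g where "v = (\<alpha> + \<beta>) / 2" and "g = (\<alpha> - \<beta>) / 2"
  have ab: "\<alpha> = v + g" "\<beta> = v - g" by (simp_all add: v_def g_def field_simps)
  have "\<bar>g\<bar> \<le> v" using assms by (auto simp: v_def g_def)
  then have gv: "g^2 \<le> v^2" by (simp add: abs_le_square_iff[symmetric])
  have eq: "(\<alpha>^2 * (U + d)^4 + \<beta>^2 * (U - d)^4) / 2
     = (v^2 + g^2) * (U^4 + 6 * U^2 * d^2 + d^4) + 2 * (v * g) * (4 * U^3 * d + 4 * U * d^3)"
    unfolding ab by (simp add: field_simps power2_eq_square power4_eq_xxxx power3_eq_cube)
  have 1: "2 * (g * U^2) * (v * (U * d)) \<le> (g * U^2)^2 + (v * (U * d))^2"
    by (rule sum_squares_bound)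
  have 2: "2 * (g * (U * d)) * (v * d^2) \<le> (g * (U * d))^2 + (v * d^2)^2"
    by (rule sum_squares_bound)
  have 3: "g^2 * (U^2 * d^2) \<le> v^2 * (U^2 * d^2)" "g^2 * d^4 \<le> v^2 * d^4"
    using gv by (auto intro!: mult_right_mono)
  have "2 * (v * g) * (4 * U^3 * d + 4 * U * d^3)
      = 4 * (2 * (g * U^2) * (v * (U * d))) + 4 * (2 * (g * (U * d)) * (v * d^2))"
    by (simp add: algebra_simps power2_eq_square power3_eq_cube)
  also have "\<dots> \<le> 4 * ((g * U^2)^2 + (v * (U * d))^2) + 4 * ((g * (U * d))^2 + (v * d^2)^2)"
    using 1 2 by (intro add_mono mult_left_mono) auto
  also have "\<dots> = 4 * (g^2 * U^4) + 4 * (v^2 * (U^2 * d^2)) + 4 * (g^2 * (U^2 * d^2)) + 4 * (v^2 * d^4)"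
    by (simp add: algebra_simps power2_eq_square power4_eq_xxxx)
  finally have 4: "2 * (v * g) * (4 * U^3 * d + 4 * U * d^3) \<le> \<dots>" .
  have "(v^2 + g^2) * (U^4 + 6 * U^2 * d^2 + d^4)
     = v^2 * U^4 + g^2 * U^4 + 6 * (v^2 * (U^2 * d^2)) + 6 * (g^2 * (U^2 * d^2)) + v^2 * d^4 + g^2 * d^4"
    by (simp add: algebra_simps)
  moreover have "0 \<le> g^2 * U^4" "0 \<le> v^2 * (U^2 * d^2)" "0 \<le> v^2 * d^4" by auto
  ultimately show ?thesis
    unfolding eq using 3 4 by (fold v_def g_def) (simp only: distrib_left; linarith)
qed

text \<open>At a node off the family the offset stays and \<open>U\<close> moves by
  \<open>d\<close>. The root branch passes without loss, since the square roots of the weights are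
  averaged. The loss is spent on the floor, which drops with the arithmetic mean of the weights, on
  the quartic term, and on jumps that carry a child out of the linear branch.\<close>

lemma bellman_split:
  assumes "0 < \<alpha>" "0 < \<beta>"
  shows "bellman (((\<alpha> + \<beta>) / 2)^2) U y \<le> (bellman (\<alpha>^2) (U + d) y + bellman (\<beta>^2) (U - d) y) / 2
    + 2000000000 * (((\<alpha> - \<beta>) / 2)^2 * U^4 + ((\<alpha> + \<beta>) / 2)^2 * (U^2 * d^2 + d^4))"
proof -
  define v z g2 where "v = (\<alpha> + \<beta>) / 2" and "z = v^2" and "g2 = ((\<alpha> - \<beta>) / 2)^2"
  have v: "0 < v" and z: "0 < z" using assms by (auto simp: v_def z_def)
  have sum_sq: "(\<alpha>^2 + \<beta>^2) / 2 = z + g2"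
    by (simp add: z_def v_def g2_def power2_eq_square field_simps)
  have "\<bar>(\<alpha> - \<beta>) / 2\<bar> \<le> v" using assms by (auto simp: v_def)
  then have g2: "0 \<le> g2" "g2 \<le> z" 
    unfolding g2_def z_def by (auto simp flip: abs_le_square_iff)
  define E where "E = g2 * U^4 + z * (U^2 * d^2 + d^4)"
  have E0: "0 \<le> E" using g2 z by (simp add: E_def)
  define S where "S = (bellman (\<alpha>^2) (U + d) y + bellman (\<beta>^2) (U - d) y) / 2"
  have floor: "- (3/10) * (z + g2) \<le> S"
    unfolding S_def sum_sq[symmetric]
    using bellman_ge_floor[of "\<alpha>^2" "U + d" y] bellman_ge_floor[of "\<beta>^2" "U - d" y] by argo
  have root: "\<bar>y\<bar> - 3 * sqrt (z * \<bar>y\<bar>) \<le> S" if "4 * z \<le> \<bar>y\<bar>"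
  proof -
    have "\<alpha> \<le> 2 * v" "\<beta> \<le> 2 * v" using assms by (auto simp: v_def)
    then have "\<alpha>^2 \<le> (2 * v)^2" "\<beta>^2 \<le> (2 * v)^2" using assms by (intro power_mono; simp)+
    then have "\<alpha>^2 \<le> \<bar>y\<bar>" "\<beta>^2 \<le> \<bar>y\<bar>" using that by (auto simp: z_def)
    then have "\<bar>y\<bar> - 3 * sqrt (\<alpha>^2 * \<bar>y\<bar>) \<le> bellman (\<alpha>^2) (U + d) y"
      "\<bar>y\<bar> - 3 * sqrt (\<beta>^2 * \<bar>y\<bar>) \<le> bellman (\<beta>^2) (U - d) y"
      using assms by (auto intro!: bellman_ge_root')
    then have "\<bar>y\<bar> - 3 * (v * sqrt \<bar>y\<bar>) \<le> S"
      using assms by (simp add: S_def real_sqrt_mult v_def field_simps)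
    then show ?thesis using v by (simp add: z_def real_sqrt_mult)
  qed
  \<comment> \<open>From 1/100 on, \<open>2000000000 * U^4\<close> is at least 20 and pays for the
    drop of the floor by \<open>(3/10) * g2\<close>.\<close>
  have low: "- (3/10) * z \<le> S + 2000000000 * E" if "1/100 \<le> \<bar>U\<bar>"
  proof -
    have "(1/100)^4 \<le> \<bar>U\<bar>^4" using that by (intro power_mono) auto
    then have "g2 * (3/10) \<le> g2 * (2000000000 * U^4)" using g2 by (intro mult_left_mono) (auto simp: power_divide)
    moreover define P where "P = z * (U^2 * d^2 + d^4)"
    moreover have "0 \<le> P" using z by (simp add: P_def)
    ultimately show ?thesis using floor unfolding E_def by (simp add: distrib_left)
  qed
  have lin: "U * y - 10000000 * U^4 * z \<le> S + 2000000000 * E" if U: "\<bar>U\<bar> \<le> 3/200" and y: "\<bar>y\<bar> \<le> 10 * z"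
  proof (cases "\<bar>U + d\<bar> \<le> 1/50 \<and> \<bar>U - d\<bar> \<le> 1/50")
    case True
    then have "((U + d) * y - 10000000 * (U + d)^4 * \<alpha>^2 + ((U - d) * y - 10000000 * (U - d)^4 * \<beta>^2)) / 2 \<le> S"
      unfolding S_def using bellman_ge_linear[of "U + d" y "\<alpha>^2"] bellman_ge_linear[of "U - d" y "\<beta>^2"]
      by (intro divide_right_mono add_mono) auto
    moreover have "((U + d) * y - 10000000 * (U + d)^4 * \<alpha>^2 + ((U - d) * y - 10000000 * (U - d)^4 * \<beta>^2)) / 2
        = U * y - 10000000 * ((\<alpha>^2 * (U + d)^4 + \<beta>^2 * (U - d)^4) / 2)"
      by (simp add: field_simps)
    moreover have "(\<alpha>^2 * (U + d)^4 + \<beta>^2 * (U - d)^4) / 2 \<le> z * U^4 + 20 * E"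
      using quartic_split_bound[OF assms, of U d] by (simp add: z_def v_def g2_def E_def)
    ultimately show ?thesis using E0 by (simp add: algebra_simps)
  next
    case False
    then have "1/50 < \<bar>U\<bar> + \<bar>d\<bar>"
      using abs_triangle_ineq[of U d] abs_triangle_ineq4[of U d] by linarith
    \<comment> \<open>A child has left the linear branch, a jump of at least 1/50 - 3/200. Then
      \<open>2000000000 * d^4 \<ge> 5/4\<close>, the most demanding use of this constant: the loss
      must cover the pairing, at most \<open>3/20 * z\<close>, and a floor of at worst
      \<open>- (6/10) * z\<close>.\<close>
    then have "1/200 \<le> \<bar>d\<bar>" using U by linarith
    then have "(1/200)^4 \<le> \<bar>d\<bar>^4" by (intro power_mono) auto
    then have "1 \<le> 2000000000 * d^4" by (simp add: power_divide)
    then have "z * 1 \<le> z * (2000000000 * d^4)" using z by (intro mult_left_mono) auto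
    moreover have "z * d^4 \<le> E" using z g2 by (simp add: E_def algebra_simps)
    ultimately have "z \<le> 2000000000 * E" by simp
    moreover have "U * y \<le> 3/200 * (10 * z)"
    proof -
      have "U * y \<le> \<bar>U\<bar> * \<bar>y\<bar>" by (metis abs_ge_self abs_mult)
      also have "\<dots> \<le> 3/200 * (10 * z)" using U y by (intro mult_mono) auto
      finally show ?thesis .
    qed
    moreover have "- (6/10) * z \<le> S" using floor g2 by argo
    ultimately have "U * y \<le> S + 2000000000 * E" using z by linarith
    moreover have "0 \<le> 10000000 * U^4 * z" using z by simp
    ultimately show ?thesis by linarith
  qed
  have "bellman z U y \<le> S + 2000000000 * E"
  proof (cases "\<bar>y\<bar> \<le> 10 * z")
    case False
    then have y4: "4 * z \<le> \<bar>y\<bar>" using z by linarith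
    \<comment> \<open>As 8/25 exceeds the root of 1/10, the root branch is at least
      \<open>\<bar>y\<bar> / 25\<close>. This beats the floor and the linear branch, whose slope is
      at most 1/50, so only the lossless branch matters here.\<close>
    have "sqrt (z * \<bar>y\<bar>) \<le> 8/25 * \<bar>y\<bar>"
    proof (rule real_le_lsqrt)
      have "z * \<bar>y\<bar> \<le> (64/625 * \<bar>y\<bar>) * \<bar>y\<bar>" using False by (intro mult_right_mono) auto
      then show "z * \<bar>y\<bar> \<le> (8/25 * \<bar>y\<bar>)\<^sup>2" by (simp add: power2_eq_square)
    qed auto
    then have N2: "1/25 * \<bar>y\<bar> \<le> \<bar>y\<bar> - 3 * sqrt (z * \<bar>y\<bar>)" by linarith
    show ?thesis
    proof (rule bellman_le)
      show "- (3/10) * z \<le> S + 2000000000 * E" using root[OF y4] N2 E0 z by linarith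
      show "\<bar>y\<bar> - 3 * sqrt (z * \<bar>y\<bar>) \<le> S + 2000000000 * E" using root[OF y4] E0 by linarith
      assume "\<bar>U\<bar> \<le> 1/50"
      have "U * y \<le> \<bar>U\<bar> * \<bar>y\<bar>" by (metis abs_ge_self abs_mult)
      also have "\<dots> \<le> 1/50 * \<bar>y\<bar>" using \<open>\<bar>U\<bar> \<le> 1/50\<close> by (intro mult_right_mono) auto
      finally have "U * y \<le> 1/50 * \<bar>y\<bar>" .
      moreover have "0 \<le> 10000000 * U^4 * z" using z by simp
      ultimately show "U * y - 10000000 * U^4 * z \<le> S + 2000000000 * E" using root[OF y4] N2 E0 by linarith
    qed
  next
    case y: True
    have Uy: "\<bar>U * y\<bar> \<le> \<bar>U\<bar> * (10 * z)" using y by (simp add: abs_mult mult_left_mono)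
    have N1: "U * y - 10000000 * U^4 * z \<le> S + 2000000000 * E" if U: "\<bar>U\<bar> \<le> 1/50"
    proof (cases "\<bar>U\<bar> \<le> 3/200")
      case True then show ?thesis using lin y by simp
    next
      case False
      \<comment> \<open>Between 3/200 and 1/50 the quartic term already pushes the linear branch
        below the floor: the pairing is at most \<open>z / 5\<close>. Switching the branch off at
        1/50 thus causes no jump in this range of \<open>y\<close>.\<close>
      then have "(3/200)^4 \<le> \<bar>U\<bar>^4" by (intro power_mono) auto
      then have *: "81/160 \<le> 10000000 * U^4" by (simp add: power_divide)
      have "\<bar>U\<bar> * (10 * z) \<le> 1/50 * (10 * z)" using U z by (intro mult_right_mono) auto
      moreover have "81/160 * z \<le> 10000000 * U^4 * z" using * z by (intro mult_right_mono) auto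
      ultimately have "U * y - 10000000 * U^4 * z \<le> - (3/10) * z" using Uy z by linarith
      then show ?thesis using low False by simp
    qed
    show ?thesis
    proof (rule bellman_le)
      show "\<bar>U\<bar> \<le> 1/50 \<Longrightarrow> U * y - 10000000 * U^4 * z \<le> S + 2000000000 * E" by (rule N1)
      show "4 * z \<le> \<bar>y\<bar> \<Longrightarrow> \<bar>y\<bar> - 3 * sqrt (z * \<bar>y\<bar>) \<le> S + 2000000000 * E" using root E0 by force
      show "- (3/10) * z \<le> S + 2000000000 * E"
      proof (cases "1/100 \<le> \<bar>U\<bar>")
        case True then show ?thesis by (rule low)
      next
        case False
        \<comment> \<open>Below 1/100 the roles are reversed: the linear branch is at least
          \<open>- (1/5) * z\<close> and hides the floor, whose drop could not be paid for
          here.\<close>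
        then have "\<bar>U\<bar>^4 \<le> (1/100)^4" by (intro power_mono) auto
        then have "10000000 * U^4 \<le> 1/10" by (simp add: power_divide)
        then have "10000000 * U^4 * z \<le> 1/10 * z" using z by (intro mult_right_mono) auto
        moreover have "\<bar>U\<bar> * (10 * z) \<le> 1/100 * (10 * z)" using False z by (intro mult_right_mono) auto
        ultimately have "- (3/10) * z \<le> U * y - 10000000 * U^4 * z" using Uy z by linarith
        then show ?thesis using N1 False by simp
      qed
    qed
  qed
  then show ?thesis by (simp add: z_def v_def g2_def E_def S_def)
qed

section \<open>Dyadic step functions as arrays\<close>

primrec mean :: "nat \<Rightarrow> (nat \<Rightarrow> real) \<Rightarrow> real" where
  "mean 0 f = f 0"
| "mean (Suc m) f = (mean m f + mean m (\<lambda>i. f (2^m + i))) / 2"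

lemma mean_eq_sum: "mean m f = (\<Sum>p<2^m. f p) / 2^m"
proof (induction m arbitrary: f)
  case (Suc m)
  have "(\<Sum>p<2^Suc m. f p) = (\<Sum>p<2^m. f p) + (\<Sum>p<2^m. f (2^m + p))"
    unfolding power_Suc mult_2 by (simp add: sum.nat_group[symmetric] lessThan_atLeast0
        flip: sum.atLeastLessThan_concat[of 0 "2^m" "2^m + 2^m"] sum.shift_bounds_nat_ivl[of f 0 "2^m" "2^m", simplified] add.commute)
  then show ?case by (simp add: Suc field_simps)
qed simp

lemma mean_cong: "(\<And>p. p < 2^m \<Longrightarrow> f p = g p) \<Longrightarrow> mean m f = mean m g"
  by (simp add: mean_eq_sum)

lemma mean_add: "mean m (\<lambda>p. f p + g p) = mean m f + mean m g"
  by (simp add: mean_eq_sum sum.distrib add_divide_distrib)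

lemma mean_diff: "mean m (\<lambda>p. f p - g p) = mean m f - mean m g"
  by (simp add: mean_eq_sum sum_subtractf diff_divide_distrib)

lemma mean_cmult: "mean m (\<lambda>p. c * f p) = c * mean m f"
  by (simp add: mean_eq_sum sum_distrib_left)

lemma mean_sum: "mean m (\<lambda>p. \<Sum>j\<in>S. f j p) = (\<Sum>j\<in>S. mean m (f j))"
  by (induction S rule: infinite_finite_induct) (simp_all add: mean_eq_sum sum.distrib add_divide_distrib)

lemma mean_const [simp]: "mean m (\<lambda>p. c) = c"
  by (simp add: mean_eq_sum)

lemma mean_mono: "(\<And>p. p < 2^m \<Longrightarrow> f p \<le> g p) \<Longrightarrow> mean m f \<le> mean m g"
  by (auto simp: mean_eq_sum intro!: divide_right_mono sum_mono)

text \<open>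
  Index \<open>p < 2^m\<close> stands for the cell \<open>[p/2^m, (p+1)/2^m)\<close>, and the node \<open>(k, i)\<close> for
  \<open>[i/2^k, (i+1)/2^k)\<close>; below, \<open>A k i\<close> says that this node belongs to \<open>\<A>\<close>.
\<close>
definition left_sub :: "(nat \<Rightarrow> nat \<Rightarrow> 'a) \<Rightarrow> nat \<Rightarrow> nat \<Rightarrow> 'a" where
  "left_sub A k i = A (Suc k) i"

definition right_sub :: "(nat \<Rightarrow> nat \<Rightarrow> 'a) \<Rightarrow> nat \<Rightarrow> nat \<Rightarrow> 'a" where
  "right_sub A k i = A (Suc k) (2^k + i)"

text \<open>Haar synthesis: the value on cell \<open>p\<close> of the sum, over all nodes
  \<open>(k, i)\<close> with \<open>k < m\<close>, of \<open>c k i\<close> times the Haar function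
  of the node.\<close>

primrec synth :: "nat \<Rightarrow> (nat \<Rightarrow> nat \<Rightarrow> real) \<Rightarrow> nat \<Rightarrow> real" where
  "synth 0 c p = 0"
| "synth (Suc m) c p = (if p < 2^m then c 0 0 + synth m (left_sub c) p
     else synth m (right_sub c) (p - 2^m) - c 0 0)"

text \<open>Orthogonality to the Haar functions of the nodes in \<open>A\<close> of level below
  \<open>m\<close>, phrased through means of halves so that it follows the recursion.\<close>

primrec balanced :: "nat \<Rightarrow> (nat \<Rightarrow> nat \<Rightarrow> bool) \<Rightarrow> (nat \<Rightarrow> real) \<Rightarrow> bool" where
  "balanced 0 A U \<longleftrightarrow> True"
| "balanced (Suc m) A U \<longleftrightarrow> balanced m (left_sub A) U \<and> balanced m (right_sub A) (\<lambda>i. U (2^m + i))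
     \<and> (A 0 0 \<longrightarrow> mean m U = mean m (\<lambda>i. U (2^m + i)))"

text \<open>
  The loss against the arithmetic mean at nodes off \<open>A\<close> makes the total defect summable; at nodes in
  \<open>A\<close> only the arithmetic mean is compatible with the offset being split arbitrarily.
\<close>
primrec weight :: "nat \<Rightarrow> (nat \<Rightarrow> nat \<Rightarrow> bool) \<Rightarrow> (nat \<Rightarrow> real) \<Rightarrow> real" where
  "weight 0 A w = w 0"
| "weight (Suc m) A w =
     (let a = weight m (left_sub A) w; b = weight m (right_sub A) (\<lambda>i. w (2^m + i))
      in if A 0 0 then (a + b) / 2 else ((sqrt a + sqrt b) / 2)^2)"

text \<open>The losses of the Bellman induction, averaged over the tree and without the factor
  2000000000: the leaf term is the error in \<open>bellman_leaf\<close>, the term at a node off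
  \<open>A\<close> the error in \<open>bellman_split\<close>.\<close>

primrec defect :: "nat \<Rightarrow> (nat \<Rightarrow> nat \<Rightarrow> bool) \<Rightarrow> (nat \<Rightarrow> real) \<Rightarrow> (nat \<Rightarrow> real) \<Rightarrow> real" where
  "defect 0 A w U = w 0 * (U 0)^4"
| "defect (Suc m) A w U =
     (defect m (left_sub A) w U + defect m (right_sub A) (\<lambda>i. w (2^m + i)) (\<lambda>i. U (2^m + i))) / 2 +
     (let \<alpha> = sqrt (weight m (left_sub A) w); \<beta> = sqrt (weight m (right_sub A) (\<lambda>i. w (2^m + i)));
          d = (mean m U - mean m (\<lambda>i. U (2^m + i))) / 2
      in if A 0 0 then 0
         else ((\<alpha> - \<beta>) / 2)^2 * (mean (Suc m) U)^4
           + ((\<alpha> + \<beta>) / 2)^2 * ((mean (Suc m) U)^2 * d^2 + d^4))"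

section \<open>The Bellman induction along the dyadic tree\<close>

lemma weight_pos: "(\<And>p. 0 < w p) \<Longrightarrow> 0 < weight m A w"
proof (induction m arbitrary: A w)
  case (Suc m)
  then have "0 < weight m (left_sub A) w" "0 < weight m (right_sub A) (\<lambda>i. w (2^m + i))" by auto
  moreover from this have "0 < sqrt (weight m (left_sub A) w) + sqrt (weight m (right_sub A) (\<lambda>i. w (2^m + i)))"
    by (intro add_pos_pos) auto
  ultimately show ?case by (auto simp: Let_def)
qed simp

lemma sub_support:
  assumes "\<And>k i. \<not> A k i \<Longrightarrow> c k i = (0::real)"
  shows "\<not> left_sub A k i \<Longrightarrow> left_sub c k i = 0" "\<not> right_sub A k i \<Longrightarrow> right_sub c k i = 0"
  using assms by (auto simp: left_sub_def right_sub_def)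

text \<open>The offset \<open>s\<close> is arbitrary because the root coefficient shifts it by
  \<open>c 0 0\<close> in opposite directions on the two halves. Only one thing happens at a node:
  in \<open>A\<close> the mean of \<open>U\<close> stays and \<open>bellman_convex\<close> handles
  the offset; off \<open>A\<close> the coefficient vanishes and \<open>bellman_split\<close> handles
  the move of \<open>U\<close>.\<close>

lemma quotient_norm_lower_bound:
  assumes "\<And>p. 0 < w p" "balanced m A U" "\<And>k i. \<not> A k i \<Longrightarrow> c k i = 0"
  shows "mean m (\<lambda>p. w p * (U p)^2) + bellman (weight m A w) (mean m U) s
    \<le> mean m (\<lambda>p. \<bar>w p * U p + s + synth m c p\<bar>) + 2000000000 * defect m A w U"
  using assms
proof (induction m arbitrary: A w U c s)
  case 0
  show ?case using bellman_leaf[OF 0(1)[of 0], of "U 0" s] by simp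
next
  case (Suc m)
  define w' U' where "w' = (\<lambda>i. w (2^m + i))" and "U' = (\<lambda>i. U (2^m + i))"
  define a b where "a = weight m (left_sub A) w" and "b = weight m (right_sub A) w'"
  define \<alpha> \<beta> d where "\<alpha> = sqrt a" and "\<beta> = sqrt b" and "d = (mean m U - mean m U') / 2"
  have ab: "0 < a" "0 < b" using Suc.prems(1) by (auto simp: a_def b_def w'_def weight_pos)
  have bal: "balanced m (left_sub A) U" "balanced m (right_sub A) U'"
    using Suc.prems(2) by (auto simp: U'_def)
  have L: "mean m (\<lambda>p. w p * (U p)^2) + bellman a (mean m U) (s + c 0 0)
    \<le> mean m (\<lambda>p. \<bar>w p * U p + (s + c 0 0) + synth m (left_sub c) p\<bar>) + 2000000000 * defect m (left_sub A) w U"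
    unfolding a_def by (rule Suc.IH) (use Suc.prems bal sub_support[of A c] in auto)
  have R: "mean m (\<lambda>p. w' p * (U' p)^2) + bellman b (mean m U') (s - c 0 0)
    \<le> mean m (\<lambda>p. \<bar>w' p * U' p + (s - c 0 0) + synth m (right_sub c) p\<bar>) + 2000000000 * defect m (right_sub A) w' U'"
    unfolding b_def by (rule Suc.IH) (use Suc.prems bal sub_support[of A c] in \<open>auto simp: w'_def\<close>)
  have "mean m (\<lambda>p. \<bar>w p * U p + s + synth (Suc m) c p\<bar>) = mean m (\<lambda>p. \<bar>w p * U p + (s + c 0 0) + synth m (left_sub c) p\<bar>)"
    by (rule mean_cong) (simp add: algebra_simps)
  moreover have "mean m (\<lambda>p. \<bar>w' p * U' p + s + synth (Suc m) c (2^m + p)\<bar>) = mean m (\<lambda>p. \<bar>w' p * U' p + (s - c 0 0) + synth m (right_sub c) p\<bar>)"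
    by (rule mean_cong) (simp add: algebra_simps)
  ultimately have split: "mean (Suc m) (\<lambda>p. \<bar>w p * U p + s + synth (Suc m) c p\<bar>)
    = (mean m (\<lambda>p. \<bar>w p * U p + (s + c 0 0) + synth m (left_sub c) p\<bar>)
      + mean m (\<lambda>p. \<bar>w' p * U' p + (s - c 0 0) + synth m (right_sub c) p\<bar>)) / 2"
    by (simp add: w'_def U'_def)
  have M: "mean (Suc m) U = (mean m U + mean m U') / 2" by (simp add: U'_def)
  have node: "bellman (weight (Suc m) A w) (mean (Suc m) U) s
    \<le> (bellman a (mean m U) (s + c 0 0) + bellman b (mean m U') (s - c 0 0)) / 2
      + 2000000000 * (defect (Suc m) A w U - (defect m (left_sub A) w U + defect m (right_sub A) w' U') / 2)"
  proof (cases "A 0 0")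
    case True
    then have "mean m U' = mean m U" using Suc.prems(2) by (simp add: U'_def)
    with True bellman_convex[OF ab, of "mean m U" "s + c 0 0" "s - c 0 0"] show ?thesis
      unfolding M by (simp add: Let_def a_def b_def w'_def U'_def)
  next
    case False
    then have c: "c 0 0 = 0" using Suc.prems(3) by blast
    have "mean (Suc m) U + d = mean m U" "mean (Suc m) U - d = mean m U'" "\<alpha>^2 = a" "\<beta>^2 = b" "0 < \<alpha>" "0 < \<beta>"
      using ab unfolding M by (auto simp: d_def \<alpha>_def \<beta>_def field_simps)
    with bellman_split[of \<alpha> \<beta> "mean (Suc m) U" s d] False c show ?thesis
      by (simp add: Let_def \<alpha>_def \<beta>_def a_def b_def w'_def U'_def d_def del: mean.simps)
  qed
  have "mean (Suc m) (\<lambda>p. w p * (U p)^2) = (mean m (\<lambda>p. w p * (U p)^2) + mean m (\<lambda>p. w' p * (U' p)^2)) / 2"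
    by (simp add: w'_def U'_def)
  with L R node split show ?case by argo
qed

section \<open>Averages over signs\<close>

definition sign_average :: "nat \<Rightarrow> ((nat \<Rightarrow> real) \<Rightarrow> real) \<Rightarrow> real" where
  "sign_average n g = (\<Sum>\<epsilon>\<in>sign_vectors n. g \<epsilon>) / real (card (sign_vectors n))"

lemma sign_vectors_Suc:
  "sign_vectors (Suc n) = (\<lambda>(s, \<epsilon>). \<epsilon>(n := s)) ` ({-1, 1} \<times> sign_vectors n)"
  unfolding sign_vectors_def lessThan_Suc by (subst PiE_insert_eq) auto

lemma sign_vectors_inj: "inj_on (\<lambda>(s, \<epsilon>). \<epsilon>(n := s)) ({-1, 1::real} \<times> sign_vectors n)"
  unfolding sign_vectors_def by (rule inj_combinator) auto

lemma finite_sign_vectors: "finite (sign_vectors n)"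
  unfolding sign_vectors_def by (intro finite_PiE) auto

lemma card_sign_vectors: "card (sign_vectors n) = 2^n"
  unfolding sign_vectors_def by (simp add: card_PiE card_insert_if numeral_2_eq_2)

lemma sign_average_0: "sign_average 0 g = g (\<lambda>_. undefined)"
  by (simp add: sign_average_def sign_vectors_def)

lemma sign_average_Suc:
  "sign_average (Suc n) g = sign_average n (\<lambda>\<epsilon>. (g (\<epsilon>(n := -1)) + g (\<epsilon>(n := 1))) / 2)"
proof -
  have "(\<Sum>\<epsilon>\<in>sign_vectors (Suc n). g \<epsilon>) = (\<Sum>s\<in>{-1,1}. \<Sum>\<epsilon>\<in>sign_vectors n. g (\<epsilon>(n := s)))"
    unfolding sign_vectors_Suc sum.reindex[OF sign_vectors_inj] sum.cartesian_product
    by (simp add: case_prod_unfold)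
  then show ?thesis
    by (simp add: sign_average_def card_sign_vectors sum.distrib field_simps flip: sum_divide_distrib)
qed

lemma sign_average_add: "sign_average n (\<lambda>\<epsilon>. f \<epsilon> + g \<epsilon>) = sign_average n f + sign_average n g"
  by (simp add: sign_average_def sum.distrib add_divide_distrib)

lemma sign_average_cmult: "sign_average n (\<lambda>\<epsilon>. c * f \<epsilon>) = c * sign_average n f"
  by (simp add: sign_average_def sum_distrib_left)

lemma sign_average_half: "sign_average n (\<lambda>\<epsilon>. f \<epsilon> / 2) = sign_average n f / 2"
  using sign_average_cmult[of n "1/2" f] by simp

lemma sign_average_const: "sign_average n (\<lambda>\<epsilon>. c) = c"
  by (simp add: sign_average_def card_sign_vectors)

lemma sign_average_mono: "(\<And>\<epsilon>. \<epsilon> \<in> sign_vectors n \<Longrightarrow> f \<epsilon> \<le> g \<epsilon>) \<Longrightarrow> sign_average n f \<le> sign_average n g"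
  by (auto simp: sign_average_def intro!: divide_right_mono sum_mono)

lemma sign_average_cong: "(\<And>\<epsilon>. \<epsilon> \<in> sign_vectors n \<Longrightarrow> f \<epsilon> = g \<epsilon>) \<Longrightarrow> sign_average n f = sign_average n g"
  by (simp add: sign_average_def)

lemma sum_upd: "(\<Sum>j<n. (\<epsilon>(n := s)) j * a j) = (\<Sum>j<n. \<epsilon> j * a j)"
  for n :: nat and a \<epsilon> :: "nat \<Rightarrow> real"
  by (intro sum.cong) auto

lemma sign_average_square: "sign_average n (\<lambda>\<epsilon>. (\<Sum>j<n. \<epsilon> j * a j)^2) = (\<Sum>j<n. (a j)^2)"
proof (induction n)
  case (Suc n)
  have eq: "(((\<Sum>j<Suc n. (\<epsilon>(n := -1)) j * a j)^2) + (\<Sum>j<Suc n. (\<epsilon>(n := 1)) j * a j)^2) / 2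
      = (\<Sum>j<n. \<epsilon> j * a j)^2 + (a n)^2" for \<epsilon>
  proof -
    have "((X + (-1) * b)^2 + (X + 1 * b)^2) / 2 = X^2 + b^2" for X b :: real
      by (simp add: power2_eq_square field_simps)
    then show ?thesis by (simp add: sum_upd)
  qed
  show ?case
    unfolding sign_average_Suc eq sign_average_add sign_average_const Suc by simp
qed (simp add: sign_average_0)

text \<open>Khinchine's inequality for the fourth moment. Odd powers of the last sign cancel, and
  the factor 6 is just what completes the square in the induction.\<close>

lemma sign_average_fourth: "sign_average n (\<lambda>\<epsilon>. (\<Sum>j<n. \<epsilon> j * a j)^4) \<le> 3 * (\<Sum>j<n. (a j)^2)^2"
proof (induction n)
  case (Suc n)
  have eq: "(((\<Sum>j<Suc n. (\<epsilon>(n := -1)) j * a j)^4) + (\<Sum>j<Suc n. (\<epsilon>(n := 1)) j * a j)^4) / 2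
      = (\<Sum>j<n. \<epsilon> j * a j)^4 + 6 * (a n)^2 * (\<Sum>j<n. \<epsilon> j * a j)^2 + (a n)^4" for \<epsilon>
  proof -
    have "((X + (-1) * b)^4 + (X + 1 * b)^4) / 2 = X^4 + 6 * b^2 * X^2 + b^4" for X b :: real
      by (simp add: power2_eq_square power4_eq_xxxx field_simps)
    then show ?thesis by (simp add: sum_upd)
  qed
  have "sign_average (Suc n) (\<lambda>\<epsilon>. (\<Sum>j<Suc n. \<epsilon> j * a j)^4)
      = sign_average n (\<lambda>\<epsilon>. (\<Sum>j<n. \<epsilon> j * a j)^4) + 6 * (a n)^2 * (\<Sum>j<n. (a j)^2) + (a n)^4"
    unfolding sign_average_Suc eq sign_average_add sign_average_const sign_average_cmult sign_average_square ..
  also have "\<dots> \<le> 3 * (\<Sum>j<n. (a j)^2)^2 + 6 * (a n)^2 * (\<Sum>j<n. (a j)^2) + 3 * (a n)^4"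
    using Suc by (intro add_mono) auto
  also have "\<dots> = 3 * (\<Sum>j<Suc n. (a j)^2)^2"
    by (simp add: power2_eq_square power4_eq_xxxx algebra_simps)
  finally show ?case .
qed (simp add: sign_average_0)

text \<open>AM-GM between the fourth powers, weighted by \<open>D\<close>, so that the bound is
  linear in \<open>D\<close>, the quantity that the potential can pay for.\<close>

lemma sign_average_mixed:
  assumes "(\<Sum>j<n. (a j)^2) \<le> 1"
  shows "sign_average n (\<lambda>\<epsilon>. (\<Sum>j<n. \<epsilon> j * a j)^2 * (\<Sum>j<n. \<epsilon> j * b j)^2) \<le> 3 * (\<Sum>j<n. (b j)^2)"
proof (cases "(\<Sum>j<n. (b j)^2) = 0")
  case True
  then have "\<forall>j<n. b j = 0" by (simp add: sum_nonneg_eq_0_iff)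
  then have "(\<Sum>j<n. \<epsilon> j * b j) = 0" for \<epsilon> by (intro sum.neutral) auto
  then show ?thesis using True by (simp add: sign_average_const)
next
  case False
  define D where "D = (\<Sum>j<n. (b j)^2)"
  have D: "0 < D" using False sum_nonneg[of "{..<n}" "\<lambda>j. (b j)^2"] by (auto simp: D_def less_le)
  have ineq: "x^2 * y^2 \<le> D / 2 * x^4 + 1 / (2 * D) * y^4" for x y :: real
  proof -
    have "0 \<le> (D * x^2 - y^2)^2 / (2 * D)" using D by simp
    also have "\<dots> = D / 2 * x^4 + 1 / (2 * D) * y^4 - x^2 * y^2"
      using D by (simp add: field_simps power2_eq_square power4_eq_xxxx)
    finally show ?thesis by simp
  qed
  have "sign_average n (\<lambda>\<epsilon>. (\<Sum>j<n. \<epsilon> j * a j)^2 * (\<Sum>j<n. \<epsilon> j * b j)^2)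
     \<le> sign_average n (\<lambda>\<epsilon>. D / 2 * (\<Sum>j<n. \<epsilon> j * a j)^4 + 1 / (2 * D) * (\<Sum>j<n. \<epsilon> j * b j)^4)"
    by (intro sign_average_mono ineq)
  also have "\<dots> \<le> D / 2 * (3 * 1^2) + 1 / (2 * D) * (3 * D^2)"
    unfolding sign_average_add sign_average_cmult
  proof (intro add_mono mult_left_mono)
    have "(\<Sum>j<n. (a j)^2)^2 \<le> 1^2" using assms by (intro power_mono sum_nonneg) auto
    then show "sign_average n (\<lambda>\<epsilon>. (\<Sum>j<n. \<epsilon> j * a j)^4) \<le> 3 * 1^2"
      using sign_average_fourth[of n a] by linarith
    show "sign_average n (\<lambda>\<epsilon>. (\<Sum>j<n. \<epsilon> j * b j)^4) \<le> 3 * D^2"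
      using sign_average_fourth[of n b] by (simp add: D_def)
  qed (use D in auto)
  also have "\<dots> = 3 * D" using D by (simp add: power2_eq_square)
  finally show ?thesis by (simp add: D_def)
qed

text \<open>Convexity of the squared norm: means of vectors in the unit ball of l2 remain in
  it.\<close>

lemma sum_square_mean_le:
  assumes "\<And>p. (\<Sum>j<n. (u j p)^2) \<le> 1"
  shows "(\<Sum>j<n. (mean m (u j))^2) \<le> 1"
  using assms
proof (induction m arbitrary: u)
  case (Suc m)
  define x y where "x j = mean m (u j)" and "y j = mean m (\<lambda>i. u j (2^m + i))" for j
  have "(\<Sum>j<n. (mean (Suc m) (u j))^2) \<le> (\<Sum>j<n. ((x j)^2 + (y j)^2) / 2)"
  proof (rule sum_mono)
    fix j
    have "0 \<le> (x j - y j)^2" by simp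
    then have "((x j + y j) / 2)^2 \<le> ((x j)^2 + (y j)^2) / 2"
      by (simp add: power2_eq_square field_simps)
    then show "(mean (Suc m) (u j))^2 \<le> ((x j)^2 + (y j)^2) / 2"
      by (simp only: x_def y_def mean.simps)
  qed
  also have "\<dots> = ((\<Sum>j<n. (x j)^2) + (\<Sum>j<n. (y j)^2)) / 2"
    by (simp add: sum.distrib flip: sum_divide_distrib)
  also have "\<dots> \<le> 1"
    using Suc.IH[of u] Suc.IH[of "\<lambda>j i. u j (2^m + i)"] Suc.prems by (simp add: x_def y_def)
  finally show ?case .
qed simp

text \<open>The potential \<open>weight * (33 + 4 * \<parallel>u\<parallel>\<^sup>2)\<close> pays for the defect at every node off \<open>A\<close>.\<close>
lemma sign_average_defect:
  assumes "\<And>p. 0 < w p" "\<And>p. (\<Sum>j<n. (u j p)^2) \<le> 1" "\<And>j. j < n \<Longrightarrow> balanced m A (u j)"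
  shows "sign_average n (\<lambda>\<epsilon>. defect m A w (\<lambda>p. \<Sum>j<n. \<epsilon> j * u j p))
    \<le> 3 * (38 * mean m w - weight m A w * (33 + 4 * (\<Sum>j<n. (mean m (u j))^2)))"
  using assms
proof (induction m arbitrary: A w u)
  case 0
  have "sign_average n (\<lambda>\<epsilon>. defect 0 A w (\<lambda>p. \<Sum>j<n. \<epsilon> j * u j p)) = w 0 * sign_average n (\<lambda>\<epsilon>. (\<Sum>j<n. \<epsilon> j * u j 0)^4)"
    by (simp add: sign_average_cmult)
  also have "\<dots> \<le> w 0 * (3 * (\<Sum>j<n. (u j 0)^2)^2)"
    using 0(1)[of 0] by (intro mult_left_mono sign_average_fourth) auto
  also have "\<dots> \<le> w 0 * (3 * (5 - 4 * (\<Sum>j<n. (u j 0)^2)))"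
  proof (intro mult_left_mono)
    \<comment> \<open>Origin of 38: at a leaf \<open>38 - 33 - 4 * x\<close> must dominate
      \<open>x^2\<close> on the unit interval, with equality at 1.\<close>
    have "x^2 \<le> 5 - 4 * x" if "0 \<le> x" "x \<le> 1" for x :: real
      using that mult_left_mono[of x 1 x] by (simp add: power2_eq_square)
    then show "(\<Sum>j<n. (u j 0)^2)^2 \<le> 5 - 4 * (\<Sum>j<n. (u j 0)^2)"
      using 0(2)[of 0] by (simp add: sum_nonneg)
  qed (use 0(1)[of 0] in auto)
  finally show ?case by (simp add: algebra_simps)
next
  case (Suc m)
  define w' u' where "w' = (\<lambda>i. w (2^m + i))" and "u' = (\<lambda>j i. u j (2^m + i))"
  define a b where "a = weight m (left_sub A) w" and "b = weight m (right_sub A) w'"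
  define \<alpha> \<beta> where "\<alpha> = sqrt a" and "\<beta> = sqrt b"
  define d M where "d j = (mean m (u j) - mean m (u' j)) / 2" and "M j = mean (Suc m) (u j)" for j
  define Z where "Z = weight (Suc m) A w"
  define P where "P f = (\<Sum>j<n. (f j)^2)" for f :: "nat \<Rightarrow> real"
  have ab: "0 < a" "0 < b" using Suc.prems(1) by (auto simp: a_def b_def w'_def weight_pos)
  define DL DR where "DL = sign_average n (\<lambda>\<epsilon>. defect m (left_sub A) w (\<lambda>p. \<Sum>j<n. \<epsilon> j * u j p))"
    and "DR = sign_average n (\<lambda>\<epsilon>. defect m (right_sub A) w' (\<lambda>p. \<Sum>j<n. \<epsilon> j * u' j p))"
  have L: "DL \<le> 3 * (38 * mean m w - a * (33 + 4 * P (\<lambda>j. mean m (u j))))"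
    unfolding DL_def a_def P_def by (rule Suc.IH) (use Suc.prems in auto)
  have R: "DR \<le> 3 * (38 * mean m w' - b * (33 + 4 * P (\<lambda>j. mean m (u' j))))"
    unfolding DR_def b_def P_def by (rule Suc.IH) (use Suc.prems in \<open>auto simp: w'_def u'_def\<close>)
  have mw: "mean (Suc m) w = (mean m w + mean m w') / 2" by (simp add: w'_def)
  have Md: "mean m (u j) = M j + d j" "mean m (u' j) = M j - d j" for j
    by (simp_all add: M_def d_def u'_def field_simps)
  show ?case
  proof (cases "A 0 0")
    case True
    \<comment> \<open>At a node in \<open>A\<close> no mean moves and the weights average
      arithmetically, so the potential is preserved and nothing needs to be paid.\<close>
    have "d j = 0" if "j < n" for j using Suc.prems(3)[OF that] True by (simp add: d_def u'_def)
    then have "P (\<lambda>j. mean m (u j)) = P M" "P (\<lambda>j. mean m (u' j)) = P M"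
      by (auto simp: P_def Md intro!: sum.cong)
    moreover have 1: "sign_average n (\<lambda>\<epsilon>. defect (Suc m) A w (\<lambda>p. \<Sum>j<n. \<epsilon> j * u j p)) = (DL + DR) / 2"
      using True by (simp add: DL_def DR_def w'_def u'_def sign_average_half sign_average_add)
    moreover have 2: "weight (Suc m) A w = (a + b) / 2"
      using True by (simp add: a_def b_def w'_def)
    ultimately have "(DL + DR) / 2 \<le> 3 * (38 * mean (Suc m) w - (a + b) / 2 * (33 + 4 * P M))"
      using L R unfolding mw by (simp add: field_simps)
    then show ?thesis unfolding 1 2 P_def M_def .
  next
    case False
    define g v where "g = (\<alpha> - \<beta>) / 2" and "v = (\<alpha> + \<beta>) / 2"
    have ab': "a = (v + g)^2" "b = (v - g)^2"
      using ab by (auto simp: g_def v_def \<alpha>_def \<beta>_def field_simps)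
    have W: "weight (Suc m) A w = v^2"
      using False by (simp add: v_def \<alpha>_def \<beta>_def a_def b_def w'_def)
    have PM: "P M \<le> 1" unfolding P_def M_def by (rule sum_square_mean_le) (rule Suc.prems)
    have Pu: "P (\<lambda>j. M j + d j) \<le> 1" "P (\<lambda>j. M j - d j) \<le> 1"
      unfolding P_def Md[symmetric] by (rule sum_square_mean_le; use Suc.prems in \<open>simp add: u'_def\<close>)+
    define I where "I = (\<Sum>j<n. M j * d j)"
    have Pexp: "P (\<lambda>j. M j + d j) = P M + 2 * I + P d" "P (\<lambda>j. M j - d j) = P M - 2 * I + P d"
      by (simp_all add: P_def I_def power2_eq_square algebra_simps sum.distrib sum_subtractf sum_distrib_left)
    have P0: "0 \<le> P f" for f by (simp add: P_def sum_nonneg)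
    have Pd: "P d \<le> 1" using Pu Pexp P0[of M] by linarith
    have I: "I^2 \<le> P d"
    proof -
      have "I^2 \<le> P M * P d" unfolding I_def P_def by (rule Cauchy_Schwarz_ineq_sum)
      also have "\<dots> \<le> 1 * P d" using PM P0 by (intro mult_right_mono) auto
      finally show ?thesis by simp
    qed
    have mean_U: "mean k (\<lambda>p. \<Sum>j<n. \<epsilon> j * f j p) = (\<Sum>j<n. \<epsilon> j * mean k (f j))" for k f \<epsilon>
      by (simp add: mean_sum mean_cmult)
    have dU: "(mean m (\<lambda>p. \<Sum>j<n. \<epsilon> j * u j p) - mean m (\<lambda>p. \<Sum>j<n. \<epsilon> j * u' j p)) / 2 = (\<Sum>j<n. \<epsilon> j * d j)" for \<epsilon>
      unfolding mean_U d_def by (simp add: right_diff_distrib sum_subtractf flip: sum_divide_distrib)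
    have "sign_average n (\<lambda>\<epsilon>. defect (Suc m) A w (\<lambda>p. \<Sum>j<n. \<epsilon> j * u j p))
      = sign_average n (\<lambda>\<epsilon>. (defect m (left_sub A) w (\<lambda>p. \<Sum>j<n. \<epsilon> j * u j p)
          + defect m (right_sub A) w' (\<lambda>p. \<Sum>j<n. \<epsilon> j * u' j p)) / 2
        + (g^2 * (\<Sum>j<n. \<epsilon> j * M j)^4
          + v^2 * ((\<Sum>j<n. \<epsilon> j * M j)^2 * (\<Sum>j<n. \<epsilon> j * d j)^2 + (\<Sum>j<n. \<epsilon> j * d j)^4)))"
    proof (rule sign_average_cong)
      fix \<epsilon>
      have "defect (Suc m) A w (\<lambda>p. \<Sum>j<n. \<epsilon> j * u j p) = (defect m (left_sub A) w (\<lambda>p. \<Sum>j<n. \<epsilon> j * u j p)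
          + defect m (right_sub A) w' (\<lambda>p. \<Sum>j<n. \<epsilon> j * u' j p)) / 2
        + (g^2 * (mean (Suc m) (\<lambda>p. \<Sum>j<n. \<epsilon> j * u j p))^4
          + v^2 * ((mean (Suc m) (\<lambda>p. \<Sum>j<n. \<epsilon> j * u j p))^2
              * ((mean m (\<lambda>p. \<Sum>j<n. \<epsilon> j * u j p) - mean m (\<lambda>p. \<Sum>j<n. \<epsilon> j * u' j p)) / 2)^2
            + ((mean m (\<lambda>p. \<Sum>j<n. \<epsilon> j * u j p) - mean m (\<lambda>p. \<Sum>j<n. \<epsilon> j * u' j p)) / 2)^4))"
        using False by (simp add: Let_def g_def v_def \<alpha>_def \<beta>_def a_def b_def w'_def u'_def del: mean.simps)
      then show "defect (Suc m) A w (\<lambda>p. \<Sum>j<n. \<epsilon> j * u j p) = (defect m (left_sub A) w (\<lambda>p. \<Sum>j<n. \<epsilon> j * u j p)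
          + defect m (right_sub A) w' (\<lambda>p. \<Sum>j<n. \<epsilon> j * u' j p)) / 2
        + (g^2 * (\<Sum>j<n. \<epsilon> j * M j)^4
          + v^2 * ((\<Sum>j<n. \<epsilon> j * M j)^2 * (\<Sum>j<n. \<epsilon> j * d j)^2 + (\<Sum>j<n. \<epsilon> j * d j)^4))"
        unfolding dU unfolding mean_U M_def .
    qed
    also have "\<dots> = (DL + DR) / 2 + (g^2 * sign_average n (\<lambda>\<epsilon>. (\<Sum>j<n. \<epsilon> j * M j)^4)
        + v^2 * (sign_average n (\<lambda>\<epsilon>. (\<Sum>j<n. \<epsilon> j * M j)^2 * (\<Sum>j<n. \<epsilon> j * d j)^2)
          + sign_average n (\<lambda>\<epsilon>. (\<Sum>j<n. \<epsilon> j * d j)^4)))"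
      by (simp only: sign_average_add sign_average_half sign_average_cmult DL_def DR_def)
    also have "\<dots> \<le> (DL + DR) / 2 + (g^2 * 3 + v^2 * (3 * P d + 3 * P d))"
    proof (intro add_mono mult_left_mono order_refl)
      show "sign_average n (\<lambda>\<epsilon>. (\<Sum>j<n. \<epsilon> j * M j)^4) \<le> 3"
        using sign_average_fourth[of n M] power_mono[OF PM P0, of 2] by (simp add: P_def)
      show "sign_average n (\<lambda>\<epsilon>. (\<Sum>j<n. \<epsilon> j * M j)^2 * (\<Sum>j<n. \<epsilon> j * d j)^2) \<le> 3 * P d"
        using PM unfolding P_def by (rule sign_average_mixed)
      have "(P d)^2 \<le> P d" using Pd P0[of d] mult_left_mono[of "P d" 1 "P d"] by (simp add: power2_eq_square)
      then show "sign_average n (\<lambda>\<epsilon>. (\<Sum>j<n. \<epsilon> j * d j)^4) \<le> 3 * P d"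
        using sign_average_fourth[of n d] unfolding P_def by linarith
    qed auto
    also have "\<dots> \<le> 3 * (38 * mean (Suc m) w - v^2 * (33 + 4 * P M))"
    proof -
      have "(a * (33 + 4 * P (\<lambda>j. mean m (u j))) + b * (33 + 4 * P (\<lambda>j. mean m (u' j)))) / 2
         = (v^2 + g^2) * (33 + 4 * P M + 4 * P d) + 16 * (v * g * I)"
        unfolding Md Pexp ab' by (simp add: power2_eq_square field_simps)
      \<comment> \<open>The only term of unknown sign. Completing the square takes 32 of the 33
        \<open>g^2\<close> and 2 of the 4 \<open>v^2 * P d\<close>; three times the remainder is
        exactly the loss \<open>3 * g^2 + 6 * v^2 * P d\<close>. Hence the coefficients 33 and 4 of
        the potential.\<close>
      moreover have "- (16 * (v * g * I)) \<le> 2 * (v^2 * P d) + 32 * g^2"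
      proof -
        have "0 \<le> 2 * (v * I + 4 * g)^2" by simp
        then have "- (16 * (v * g * I)) \<le> 2 * (v^2 * I^2) + 32 * g^2" by (simp add: power2_eq_square algebra_simps)
        moreover have "v^2 * I^2 \<le> v^2 * P d" using I by (intro mult_left_mono) auto
        ultimately show ?thesis by linarith
      qed
      moreover have "0 \<le> g^2 * P M" "0 \<le> g^2 * P d" using P0 by auto
      moreover have "(v^2 + g^2) * (33 + 4 * P M + 4 * P d)
        = 33 * v^2 + 33 * g^2 + 4 * (v^2 * P M) + 4 * (g^2 * P M) + 4 * (v^2 * P d) + 4 * (g^2 * P d)"
        by (simp add: algebra_simps)
      moreover have "v^2 * (33 + 4 * P M) = 33 * v^2 + 4 * (v^2 * P M)" by (simp add: algebra_simps)
      moreover have "v^2 * (3 * P d + 3 * P d) = 6 * (v^2 * P d)" by simp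
      ultimately show ?thesis using L R unfolding mw by argo
    qed
    finally show ?thesis unfolding P_def M_def W .
  qed
qed

section \<open>Haar sums and the minimiser\<close>

lemma synth_cong:
  assumes "\<And>k i. k < m \<Longrightarrow> i < 2^k \<Longrightarrow> c k i = c' k i" "p < 2^m"
  shows "synth m c p = synth m c' p"
  using assms
proof (induction m arbitrary: c c' p)
  case (Suc m)
  have "synth m (left_sub c) q = synth m (left_sub c') q" "synth m (right_sub c) q = synth m (right_sub c') q"
    if "q < 2^m" for q
    by (rule Suc.IH; use Suc.prems(1) that in \<open>auto simp: left_sub_def right_sub_def\<close>)+
  moreover have "c 0 0 = c' 0 0" using Suc.prems(1)[of 0 0] by simp
  ultimately show ?case using Suc.prems(2) by auto
qed simp

lemma synth_add: "synth m (\<lambda>k i. c k i + c' k i) p = synth m c p + synth m c' p"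
proof (induction m arbitrary: c c' p)
  case (Suc m)
  have "left_sub (\<lambda>k i. c k i + c' k i) = (\<lambda>k i. left_sub c k i + left_sub c' k i)"
    "right_sub (\<lambda>k i. c k i + c' k i) = (\<lambda>k i. right_sub c k i + right_sub c' k i)"
    by (simp_all add: fun_eq_iff left_sub_def right_sub_def)
  then show ?case by (simp add: Suc)
qed simp

lemma synth_cmult: "synth m (\<lambda>k i. r * c k i) p = r * synth m c p"
proof (induction m arbitrary: c p)
  case (Suc m)
  have "left_sub (\<lambda>k i. r * c k i) = (\<lambda>k i. r * left_sub c k i)"
    "right_sub (\<lambda>k i. r * c k i) = (\<lambda>k i. r * right_sub c k i)"
    by (simp_all add: fun_eq_iff left_sub_def right_sub_def)
  then show ?case by (simp add: Suc algebra_simps)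
qed simp

lemma synth_zero: "synth m (\<lambda>k i. 0) p = 0"
  using synth_cmult[of m 0 "\<lambda>k i. 0" p] by simp

lemma synth_sum: "synth m (\<lambda>k i. \<Sum>a\<in>S. c a k i) p = (\<Sum>a\<in>S. synth m (c a) p)"
  by (induction S rule: infinite_finite_induct) (simp_all add: synth_zero synth_add)

lemma mean_synth: "mean m (synth m c) = 0"
proof (induction m arbitrary: c)
  case (Suc m)
  have "mean m (synth (Suc m) c) = mean m (\<lambda>p. c 0 0 + synth m (left_sub c) p)"
    "mean m (\<lambda>i. synth (Suc m) c (2^m + i)) = mean m (\<lambda>p. synth m (right_sub c) p - c 0 0)"
    by (rule mean_cong; simp)+
  then show ?case by (simp add: Suc mean_add mean_diff del: synth.simps)
qed simp

text \<open>The root coefficient is a mean over the left half, hence at most \<open>M\<close>.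
  Removing it at most doubles the bound on each half, which costs a factor 2 per level. This
  supplies the compactness for the minimisation.\<close>

lemma synth_coeff_bound:
  assumes "\<And>p. p < 2^m \<Longrightarrow> \<bar>synth m c p\<bar> \<le> M" "k < m" "i < 2^k"
  shows "\<bar>c k i\<bar> \<le> 2^m * M"
  using assms
proof (induction m arbitrary: c M k i)
  case (Suc m)
  have M0: "0 \<le> M" using Suc.prems(1)[of 0] by (simp split: if_splits)
  have l: "\<bar>c 0 0 + synth m (left_sub c) p\<bar> \<le> M" and r: "\<bar>synth m (right_sub c) p - c 0 0\<bar> \<le> M" if "p < 2^m" for p
    using Suc.prems(1)[of p] Suc.prems(1)[of "2^m + p"] that by auto
  have "c 0 0 = mean m (\<lambda>p. c 0 0 + synth m (left_sub c) p)" by (simp add: mean_add mean_synth)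
  also have "\<dots> \<le> mean m (\<lambda>p. M)" using l by (intro mean_mono) force
  finally have 1: "c 0 0 \<le> M" by simp
  have "- M = mean m (\<lambda>p. - M)" by simp
  also have "\<dots> \<le> mean m (\<lambda>p. c 0 0 + synth m (left_sub c) p)" using l by (intro mean_mono) force
  also have "\<dots> = c 0 0" by (simp add: mean_add mean_synth)
  finally have c0: "\<bar>c 0 0\<bar> \<le> M" using 1 by simp
  have "1 * M \<le> 2^Suc m * M" using M0 by (intro mult_right_mono one_le_power) auto
  then have M: "M \<le> 2^Suc m * M" by simp
  show ?case
  proof (cases k)
    case 0
    then show ?thesis using c0 M Suc.prems(3) by simp
  next
    case (Suc k')
    have bl: "\<bar>synth m (left_sub c) p\<bar> \<le> 2 * M" and br: "\<bar>synth m (right_sub c) p\<bar> \<le> 2 * M" if "p < 2^m" for p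
      using l[OF that] r[OF that] c0 by linarith+
    have k': "k' < m" using Suc Suc.prems(2) by simp
    show ?thesis
    proof (cases "i < 2^k'")
      case True
      have "\<bar>left_sub c k' i\<bar> \<le> 2^m * (2 * M)" by (rule Suc.IH[OF bl k' True])
      then show ?thesis by (simp add: left_sub_def Suc)
    next
      case False
      then have i: "i - 2^k' < 2^k'" using Suc.prems(3) Suc by simp
      have "\<bar>right_sub c k' (i - 2^k')\<bar> \<le> 2^m * (2 * M)" by (rule Suc.IH[OF br k' i])
      then show ?thesis using False by (simp add: right_sub_def Suc)
    qed
  qed
qed simp

text \<open>Haar sums living in one half, extended by zero, test the balance of that subtree; the
  Haar function of the root compares the two means.\<close>

lemma balancedI:
  assumes "\<And>e. (\<And>k i. \<not> A k i \<Longrightarrow> e k i = 0) \<Longrightarrow> mean m (\<lambda>p. u p * synth m e p) = 0"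
  shows "balanced m A u"
  using assms
proof (induction m arbitrary: A u)
  case (Suc m)
  have split: "mean m (\<lambda>p. u p * (e 0 0 + synth m (left_sub e) p))
      + mean m (\<lambda>p. u (2^m + p) * (synth m (right_sub e) p - e 0 0)) = 0"
    if "\<And>k i. \<not> A k i \<Longrightarrow> e k i = 0" for e
  proof -
    have "mean m (\<lambda>p. u p * synth (Suc m) e p) = mean m (\<lambda>p. u p * (e 0 0 + synth m (left_sub e) p))"
      "mean m (\<lambda>p. u (2^m + p) * synth (Suc m) e (2^m + p)) = mean m (\<lambda>p. u (2^m + p) * (synth m (right_sub e) p - e 0 0))"
      by (rule mean_cong; simp)+
    moreover have "mean (Suc m) (\<lambda>p. u p * synth (Suc m) e p) = 0"
      by (rule Suc.prems) (rule that)
    ultimately show ?thesis by (simp del: synth.simps)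
  qed
  show ?case
    unfolding balanced.simps
  proof (intro conjI impI)
    show "balanced m (left_sub A) u"
    proof (rule Suc.IH)
      fix e :: "nat \<Rightarrow> nat \<Rightarrow> real" assume e: "\<And>k i. \<not> left_sub A k i \<Longrightarrow> e k i = 0"
      \<comment> \<open>In level \<open>Suc k'\<close> the right half starts at index
        \<open>2^k'\<close>; the cutoff keeps the left coefficients from leaking into it.\<close>
      define e' where "e' k i = (case k of 0 \<Rightarrow> 0 | Suc k' \<Rightarrow> if i < 2^k' then e k' i else 0)" for k i
      have "e' k i = 0" if "\<not> A k i" for k i
        using e that by (auto simp: e'_def left_sub_def split: nat.split)
      note * = split[of e', OF this]
      have "synth m (left_sub e') p = synth m e p" "synth m (right_sub e') p = synth m (\<lambda>k i. 0) p" if "p < 2^m" for p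
        using that by (auto simp: e'_def left_sub_def right_sub_def intro!: synth_cong)
      then have "mean m (\<lambda>p. u p * (e' 0 0 + synth m (left_sub e') p)) = mean m (\<lambda>p. u p * synth m e p)"
        "mean m (\<lambda>p. u (2^m + p) * (synth m (right_sub e') p - e' 0 0)) = mean m (\<lambda>p. 0)"
        by (intro mean_cong; simp add: e'_def synth_zero)+
      with * show "mean m (\<lambda>p. u p * synth m e p) = 0" by simp
    qed
    show "balanced m (right_sub A) (\<lambda>i. u (2^m + i))"
    proof (rule Suc.IH)
      fix e :: "nat \<Rightarrow> nat \<Rightarrow> real" assume e: "\<And>k i. \<not> right_sub A k i \<Longrightarrow> e k i = 0"
      define e' where "e' k i = (case k of 0 \<Rightarrow> 0 | Suc k' \<Rightarrow> if i < 2^k' then 0 else e k' (i - 2^k'))" for k i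
      have "e' k i = 0" if "\<not> A k i" for k i
        using e that by (auto simp: e'_def right_sub_def split: nat.split)
      note * = split[of e', OF this]
      have "synth m (right_sub e') p = synth m e p" "synth m (left_sub e') p = synth m (\<lambda>k i. 0) p" if "p < 2^m" for p
        using that by (auto simp: e'_def left_sub_def right_sub_def intro!: synth_cong)
      then have "mean m (\<lambda>p. u p * (e' 0 0 + synth m (left_sub e') p)) = mean m (\<lambda>p. 0)"
        "mean m (\<lambda>p. u (2^m + p) * (synth m (right_sub e') p - e' 0 0)) = mean m (\<lambda>p. u (2^m + p) * synth m e p)"
        by (intro mean_cong; simp add: e'_def synth_zero)+
      with * show "mean m (\<lambda>p. u (2^m + p) * synth m e p) = 0" by simp
    qed
    assume "A 0 0"
    define e where "e k i = (if k = 0 \<and> i = (0::nat) then 1 else 0 :: real)" for k :: nat and i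
    have "left_sub e = (\<lambda>k i. 0)" "right_sub e = (\<lambda>k i. 0)" by (simp_all add: fun_eq_iff e_def left_sub_def right_sub_def)
    moreover have "e k i = 0" if "\<not> A k i" for k i using that \<open>A 0 0\<close> by (cases "k = 0 \<and> i = 0") (auto simp: e_def)
    note * = split[of e, OF this]
    ultimately have "mean m (\<lambda>p. u p * 1) + mean m (\<lambda>p. u (2^m + p) * (- 1)) = 0"
      by (simp add: synth_zero e_def)
    then show "mean m u = mean m (\<lambda>i. u (2^m + i))"
      using mean_cmult[of m "-1" "\<lambda>p. u (2^m + p)"] by simp
  qed
qed simp

lemma defect_cmult: "defect m A w (\<lambda>p. r * U p) = r^4 * defect m A w U"
proof (induction m arbitrary: A w U)
  case (Suc m)
  have *: "(r * L + r * R) / 2 = r * ((L + R) / 2)" "(r * L - r * R) / 2 = r * ((L - R) / 2)"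
    "r^4 * L + r^4 * R = r^4 * (L + R)"
    "X * (r * K)^4 + Y * ((r * K)^2 * (r * D)^2 + (r * D)^4) = r^4 * (X * K^4 + Y * (K^2 * D^2 + D^4))"
    for L R X Y K D :: real
    by (simp_all add: power_mult_distrib field_simps flip: power_add)
  show ?case
    unfolding defect.simps mean.simps mean_cmult Suc * Let_def by (simp add: distrib_left)
qed (simp add: power_mult_distrib)

text \<open>Minkowski's inequality, from the triangle inequality at each halving. It passes from the
  L1(l2) norm of the lift to the l2 sum of the L1 norms.\<close>

lemma L2_set_mean_le: "L2_set (\<lambda>j. mean m (g j)) S \<le> mean m (\<lambda>p. L2_set (\<lambda>j. g j p) S)"
proof (induction m arbitrary: g)
  case (Suc m)
  have "L2_set (\<lambda>j. mean (Suc m) (g j)) S = L2_set (\<lambda>j. mean m (g j) + mean m (\<lambda>i. g j (2^m + i))) S / 2"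
    using L2_set_right_distrib[of "1/2" "\<lambda>j. mean m (g j) + mean m (\<lambda>i. g j (2^m + i))" S] by simp
  also have "\<dots> \<le> (L2_set (\<lambda>j. mean m (g j)) S + L2_set (\<lambda>j. mean m (\<lambda>i. g j (2^m + i))) S) / 2"
    by (intro divide_right_mono L2_set_triangle_ineq) auto
  also have "\<dots> \<le> mean (Suc m) (\<lambda>p. L2_set (\<lambda>j. g j p) S)"
    using Suc[of g] Suc[of "\<lambda>j i. g j (2^m + i)"] by simp
  finally show ?case .
qed simp

section \<open>Existence and stationarity of the minimiser\<close>

text \<open>The reindexing \<open>g\<close> is arbitrary because passing to a subtree changes which
  coordinates of \<open>C\<close> are read.\<close>

lemma continuous_on_synth:
  "continuous_on S (\<lambda>C. synth m (\<lambda>k i. C (g k i)) p)"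
proof (induction m arbitrary: g p)
  case (Suc m)
  have "continuous_on S (\<lambda>C. C (g 0 0))"
    by (rule continuous_on_subset[OF continuous_on_product_coordinates]) simp
  moreover have "continuous_on S (\<lambda>C. synth m (left_sub (\<lambda>k i. C (g k i))) p)"
    "continuous_on S (\<lambda>C. synth m (right_sub (\<lambda>k i. C (g k i))) (p - 2^m))"
    using Suc[of "left_sub g" p] Suc[of "right_sub g" "p - 2^m"]
    by (simp_all add: left_sub_def[abs_def] right_sub_def[abs_def])
  ultimately show ?case by (cases "p < 2^m") (auto intro!: continuous_intros)
qed simp

text \<open>Tychonoff's theorem; coefficient arrays have infinitely many coordinates, and function
  types carry the product topology.\<close>

lemma compact_box:
  fixes B :: "'a \<Rightarrow> real set"
  assumes "\<And>i. compact (B i)"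
  shows "compact (PiE UNIV B)"
proof -
  have "compactin (product_topology (\<lambda>i. euclidean) UNIV) (PiE UNIV B)"
    using assms by (simp add: compactin_PiE)
  then show ?thesis by (simp add: euclidean_product_topology)
qed

text \<open>A competitor no worse than the zero coefficients has bounded values on every cell, hence
  bounded coefficients. A minimum over a compact box is therefore global.\<close>

lemma minimiser_exists:
  fixes x :: "nat \<Rightarrow> nat \<Rightarrow> real"
  assumes "0 < \<eta>"
  obtains c :: "nat \<Rightarrow> nat \<Rightarrow> nat \<Rightarrow> real" where
    "\<And>j k i. \<not> A k i \<Longrightarrow> c j k i = 0"
    "\<And>c'. (\<And>j k i. \<not> A k i \<Longrightarrow> c' j k i = 0) \<Longrightarrow>
       mean m (\<lambda>p. sqrt ((\<Sum>j<n. (x j p + synth m (c j) p)^2) + \<eta>^2))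
       \<le> mean m (\<lambda>p. sqrt ((\<Sum>j<n. (x j p + synth m (c' j) p)^2) + \<eta>^2))"
proof -
  define \<Psi> where "\<Psi> c = mean m (\<lambda>p. sqrt ((\<Sum>j<n. (x j p + synth m (c j) p)^2) + \<eta>^2))"
    for c :: "nat \<Rightarrow> nat \<Rightarrow> nat \<Rightarrow> real"
  define X where "X = (\<Sum>j<n. \<Sum>p<2^m. \<bar>x j p\<bar>)"
  \<comment> \<open>A value on a cell is at most \<open>2^m\<close> times the mean, removing
    \<open>x\<close> costs \<open>X\<close>, and \<open>synth_coeff_bound\<close> costs another
    \<open>2^m\<close>.\<close>
  define M where "M = 2^m * (2^m * \<Psi> (\<lambda>j k i. 0) + X)"
  define B where "B = (\<lambda>(j :: nat, k, i). if A k i then {-M..M} else {0})"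
  have M0: "0 \<le> M"
    unfolding M_def \<Psi>_def X_def mean_eq_sum
    by (intro mult_nonneg_nonneg add_nonneg_nonneg divide_nonneg_nonneg sum_nonneg) (auto intro!: add_nonneg_nonneg sum_nonneg)
  have "compact (PiE UNIV B)"
    by (rule compact_box) (auto simp: B_def)
  moreover have "(\<lambda>_. 0) \<in> PiE UNIV B" using M0 by (auto simp: B_def)
  then have "PiE UNIV B \<noteq> {}" by blast
  moreover have "continuous_on (PiE UNIV B) (\<lambda>C. \<Psi> (\<lambda>j k i. C (j, k, i)))"
    unfolding \<Psi>_def mean_eq_sum by (intro continuous_intros continuous_on_synth) auto
  ultimately obtain C where C: "C \<in> PiE UNIV B"
    "\<And>C'. C' \<in> PiE UNIV B \<Longrightarrow> \<Psi> (\<lambda>j k i. C (j, k, i)) \<le> \<Psi> (\<lambda>j k i. C' (j, k, i))"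
    using continuous_attains_inf[of "PiE UNIV B" "\<lambda>C. \<Psi> (\<lambda>j k i. C (j, k, i))"] by blast
  show ?thesis
  proof (rule that[of "\<lambda>j k i. C (j, k, i)"])
    show "C (j, k, i) = 0" if "\<not> A k i" for j k i
    proof -
      have "C (j, k, i) \<in> B (j, k, i)" using C(1) by blast
      then show ?thesis using that by (simp add: B_def)
    qed
    fix c' :: "nat \<Rightarrow> nat \<Rightarrow> nat \<Rightarrow> real" assume c': "\<And>j k i. \<not> A k i \<Longrightarrow> c' j k i = 0"
    have "\<Psi> (\<lambda>j k i. C (j, k, i)) \<le> \<Psi> c'"
    proof (cases "\<Psi> c' \<le> \<Psi> (\<lambda>j k i. 0)")
      case True
      \<comment> \<open>Coefficients outside the tree do not affect the value but might leave the
        box.\<close>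
      define c'' where "c'' j k i = (if j < n \<and> k < m \<and> i < 2^k then c' j k i else 0)" for j k i
      have "\<Psi> c'' = \<Psi> c'"
      proof -
        have "synth m (c'' j) p = synth m (c' j) p" if "j < n" "p < 2^m" for j p
          using that by (intro synth_cong) (auto simp: c''_def)
        then show ?thesis unfolding \<Psi>_def by (intro mean_cong) simp
      qed
      have bound: "\<bar>c' j k i\<bar> \<le> M" if j: "j < n" and ki: "k < m" "i < 2^k" for j k i
        unfolding M_def
      proof (rule synth_coeff_bound[OF _ ki])
        fix p :: nat assume p: "p < 2^m"
        define h where "h q = sqrt ((\<Sum>j<n. (x j q + synth m (c' j) q)^2) + \<eta>^2)" for q
        have "\<bar>x j p + synth m (c' j) p\<bar> = sqrt ((x j p + synth m (c' j) p)^2)" by simp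
        also have "\<dots> \<le> h p"
          unfolding h_def
        proof (rule real_sqrt_le_mono)
          have "(x j p + synth m (c' j) p)^2 \<le> (\<Sum>j<n. (x j p + synth m (c' j) p)^2)"
            using j by (intro member_le_sum) auto
          then show "(x j p + synth m (c' j) p)^2 \<le> (\<Sum>j<n. (x j p + synth m (c' j) p)^2) + \<eta>^2"
            using zero_le_power2[of \<eta>] by linarith
        qed
        also have "\<dots> \<le> (\<Sum>q<2^m. h q)"
          using p by (intro member_le_sum) (auto simp: h_def intro!: add_nonneg_nonneg sum_nonneg)
        also have "\<dots> = 2^m * \<Psi> c'" by (simp add: \<Psi>_def mean_eq_sum h_def)
        also have "\<dots> \<le> 2^m * \<Psi> (\<lambda>j k i. 0)" using True by (intro mult_left_mono) auto
        finally have "\<bar>x j p + synth m (c' j) p\<bar> \<le> 2^m * \<Psi> (\<lambda>j k i. 0)" .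
        moreover have "\<bar>x j p\<bar> \<le> X"
        proof -
          have "\<bar>x j p\<bar> \<le> (\<Sum>p<2^m. \<bar>x j p\<bar>)" using p by (intro member_le_sum) auto
          also have "\<dots> \<le> X" unfolding X_def using j by (intro member_le_sum) (auto intro: sum_nonneg)
          finally show ?thesis .
        qed
        ultimately show "\<bar>synth m (c' j) p\<bar> \<le> 2^m * \<Psi> (\<lambda>j k i. 0) + X" by linarith
      qed
      have "(\<lambda>(j, k, i). c'' j k i) \<in> PiE UNIV B"
        using bound c' M0 by (fastforce simp: B_def c''_def abs_le_iff)
      from C(2)[OF this] \<open>\<Psi> c'' = \<Psi> c'\<close> show ?thesis by simp
    next
      case False
      have "\<Psi> (\<lambda>j k i. C (j, k, i)) \<le> \<Psi> (\<lambda>j k i. 0)"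
        using C(2)[OF \<open>(\<lambda>_. 0) \<in> PiE UNIV B\<close>] .
      then show ?thesis using False by linarith
    qed
    then show "mean m (\<lambda>p. sqrt ((\<Sum>j<n. (x j p + synth m (\<lambda>k i. C (j, k, i)) p)^2) + \<eta>^2))
       \<le> mean m (\<lambda>p. sqrt ((\<Sum>j<n. (x j p + synth m (c' j) p)^2) + \<eta>^2))"
      by (simp add: \<Psi>_def)
  qed
qed

lemma linear_coeff_zero:
  fixes b d :: real
  assumes "\<And>t. 0 \<le> t * b + t^2 * d"
  shows "b = 0"
proof (rule ccontr)
  assume "b \<noteq> 0"
  \<comment> \<open>With \<open>e > d\<close> the step \<open>t = - b / e\<close> is so short that
    the linear term wins.\<close>
  define e where "e = \<bar>d\<bar> + 1"
  have e: "0 < e" "d < e" by (auto simp: e_def)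
  have "0 \<le> (- b / e) * b + (- b / e)^2 * d" by (rule assms)
  also have "\<dots> = (b / e)^2 * (d - e)" using e by (simp add: field_simps power2_eq_square)
  also have "\<dots> < 0" using e \<open>b \<noteq> 0\<close> by (intro mult_pos_neg) auto
  finally show False by simp
qed

text \<open>Since \<open>sqrt a \<le> (a / w + w) / 2\<close> with equality at \<open>a = w\<^sup>2\<close>, the minimum is compared
  with a quadratic polynomial in the perturbation.\<close>
lemma minimiser_balanced:
  fixes x :: "nat \<Rightarrow> nat \<Rightarrow> real"
  assumes "0 < \<eta>" "j < n"
    and supp: "\<And>j k i. \<not> A k i \<Longrightarrow> c j k i = 0"
    and min: "\<And>c'. (\<And>j k i. \<not> A k i \<Longrightarrow> c' j k i = 0) \<Longrightarrow>
       mean m (\<lambda>p. sqrt ((\<Sum>j<n. (x j p + synth m (c j) p)^2) + \<eta>^2))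
       \<le> mean m (\<lambda>p. sqrt ((\<Sum>j<n. (x j p + synth m (c' j) p)^2) + \<eta>^2))"
  defines "w \<equiv> \<lambda>p. sqrt ((\<Sum>j<n. (x j p + synth m (c j) p)^2) + \<eta>^2)"
  shows "balanced m A (\<lambda>p. (x j p + synth m (c j) p) / w p)"
proof (rule balancedI)
  fix e :: "nat \<Rightarrow> nat \<Rightarrow> real" assume e: "\<And>k i. \<not> A k i \<Longrightarrow> e k i = 0"
  define f where "f l p = x l p + synth m (c l) p" for l p
  have w_def': "w p = sqrt ((\<Sum>l<n. (f l p)^2) + \<eta>^2)" for p by (simp add: w_def f_def)
  have sq_pos: "0 < (\<Sum>l<n. (f l p)^2) + \<eta>^2" for p
    using assms(1) by (intro add_nonneg_pos sum_nonneg) auto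
  then have w: "0 < w p" "(w p)^2 = (\<Sum>l<n. (f l p)^2) + \<eta>^2" for p
    unfolding w_def' by (auto simp: less_imp_le)
  have "0 \<le> t * mean m (\<lambda>p. f j p / w p * synth m e p) + t^2 * mean m (\<lambda>p. (synth m e p)^2 / w p / 2)" for t
  proof -
    \<comment> \<open>Only the lift of \<open>x j\<close> is perturbed, along Haar functions in
      \<open>A\<close>, so the competitor is admissible.\<close>
    define c' where "c' l = (if l = j then (\<lambda>k i. c l k i + t * e k i) else c l)" for l
    have s: "synth m (c' l) p = synth m (c l) p + (if l = j then t * synth m e p else 0)" for l p
      by (simp add: c'_def synth_add synth_cmult)
    have sum: "(\<Sum>l<n. (x l p + synth m (c' l) p)^2) + \<eta>^2 = (w p)^2 + 2 * t * f j p * synth m e p + t^2 * (synth m e p)^2" for p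
    proof -
      have "(x l p + synth m (c' l) p)^2 = (f l p)^2 + (if l = j then 2 * t * f l p * synth m e p + t^2 * (synth m e p)^2 else 0)" for l
        by (simp add: s f_def power2_eq_square algebra_simps)
      then show ?thesis unfolding w(2) using assms(2) by (simp add: sum.distrib)
    qed
    have "c' l k i = 0" if "\<not> A k i" for l k i using that supp e by (simp add: c'_def)
    then have "mean m w \<le> mean m (\<lambda>p. sqrt ((\<Sum>l<n. (x l p + synth m (c' l) p)^2) + \<eta>^2))"
      unfolding w_def by (rule min)
    also have "\<dots> \<le> mean m (\<lambda>p. w p + (t * (f j p / w p * synth m e p) + t^2 * ((synth m e p)^2 / w p / 2)))"
    proof (rule mean_mono)
      fix p
      define a where "a = (w p)^2 + 2 * t * f j p * synth m e p + t^2 * (synth m e p)^2"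
      have "0 \<le> a" unfolding a_def sum[symmetric] by (intro add_nonneg_nonneg sum_nonneg) auto
      have "0 \<le> (sqrt a - w p)^2 / w p / 2" using w(1)[of p] by (intro divide_nonneg_pos) auto
      also have "\<dots> = (a / w p + w p) / 2 - sqrt a"
        using w(1)[of p] \<open>0 \<le> a\<close> by (simp add: power2_diff field_simps) (simp add: power2_eq_square)
      finally have "sqrt a \<le> (a / w p + w p) / 2" by simp
      also have "\<dots> = w p + (t * (f j p / w p * synth m e p) + t^2 * ((synth m e p)^2 / w p / 2))"
        using w(1)[of p] by (simp add: a_def field_simps power2_eq_square)
      finally show "sqrt ((\<Sum>l<n. (x l p + synth m (c' l) p)^2) + \<eta>^2)
        \<le> w p + (t * (f j p / w p * synth m e p) + t^2 * ((synth m e p)^2 / w p / 2))"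
        unfolding sum a_def .
    qed
    also have "\<dots> = mean m w + (t * mean m (\<lambda>p. f j p / w p * synth m e p) + t^2 * mean m (\<lambda>p. (synth m e p)^2 / w p / 2))"
      by (simp add: mean_add mean_cmult del: times_divide_eq_left times_divide_eq_right)
    finally show ?thesis by simp
  qed
  then have "mean m (\<lambda>p. f j p / w p * synth m e p) = 0" by (rule linear_coeff_zero)
  then show "mean m (\<lambda>p. (x j p + synth m (c j) p) / w p * synth m e p) = 0" by (simp add: f_def)
qed

section \<open>The cotype inequality for dyadic arrays\<close>

text \<open>\<open>c \<epsilon>\<close> is meant as a nearly optimal correction of the signed sum
  and may depend on the signs; \<open>b\<close> comes from the one minimiser and does not. The
  summand \<open>2 * \<eta>\<close> is the price of the smoothing.\<close>

lemma finite_cotype: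
  fixes x :: "nat \<Rightarrow> nat \<Rightarrow> real" and c :: "(nat \<Rightarrow> real) \<Rightarrow> nat \<Rightarrow> nat \<Rightarrow> real"
  assumes c: "\<And>\<epsilon> k i. \<not> A k i \<Longrightarrow> c \<epsilon> k i = 0" and \<eta>: "0 < \<eta>"
  obtains b :: "nat \<Rightarrow> nat \<Rightarrow> nat \<Rightarrow> real" where "\<And>j k i. \<not> A k i \<Longrightarrow> b j k i = 0"
    "L2_set (\<lambda>j. mean m (\<lambda>p. \<bar>x j p + synth m (b j) p\<bar>)) {..<n}
      \<le> 2000000 * sign_average n (\<lambda>\<epsilon>. mean m (\<lambda>p. \<bar>(\<Sum>j<n. \<epsilon> j * x j p) + synth m (c \<epsilon>) p\<bar>)) + 2 * \<eta>"
proof -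
  from minimiser_exists[OF \<eta>, where A = A and m = m and n = n and x = x] obtain b where b: "\<And>j k i. \<not> A k i \<Longrightarrow> b j k i = 0"
    "\<And>c'. (\<And>j k i. \<not> A k i \<Longrightarrow> c' j k i = 0) \<Longrightarrow>
       mean m (\<lambda>p. sqrt ((\<Sum>j<n. (x j p + synth m (b j) p)^2) + \<eta>^2))
       \<le> mean m (\<lambda>p. sqrt ((\<Sum>j<n. (x j p + synth m (c' j) p)^2) + \<eta>^2))"
    by blast
  define f where "f j p = x j p + synth m (b j) p" for j p
  define w where "w p = sqrt ((\<Sum>j<n. (f j p)^2) + \<eta>^2)" for p
  define u where "u j p = f j p / w p" for j p
  have sq_pos: "0 < (\<Sum>l<n. (f l p)^2) + \<eta>^2" for p
    using \<eta> by (intro add_nonneg_pos sum_nonneg) auto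
  then have w: "0 < w p" "(w p)^2 = (\<Sum>l<n. (f l p)^2) + \<eta>^2" for p
    unfolding w_def by (auto simp: less_imp_le)
  have w_ge: "\<eta> \<le> w p" for p
    unfolding w_def using \<eta> by (intro real_le_rsqrt) (simp add: sum_nonneg)
  have bal: "balanced m A (u j)" if "j < n" for j
    using minimiser_balanced[OF \<eta> that b] by (simp add: u_def[abs_def] w_def[abs_def] f_def[abs_def])
  have u_sq: "(\<Sum>j<n. (u j p)^2) = ((w p)^2 - \<eta>^2) / (w p)^2" for p
    using w(2)[of p] by (simp add: u_def power_divide flip: sum_divide_distrib)
  have u_le: "(\<Sum>j<n. (u j p)^2) \<le> 1" for p
    using w(1)[of p] by (simp add: u_sq divide_le_eq)
  define Z where "Z = weight m A w"
  have Z: "0 < Z" unfolding Z_def by (rule weight_pos) (rule w)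
  define U where "U \<epsilon> p = (\<Sum>j<n. \<epsilon> j * u j p)" for \<epsilon> p
  define N where "N \<epsilon> = mean m (\<lambda>p. \<bar>(\<Sum>j<n. \<epsilon> j * x j p) + synth m (c \<epsilon>) p\<bar>)" for \<epsilon>
  \<comment> \<open>The reciprocal of the \<lambda> of the overview. As
    \<open>2000000000 * 114 * r^2 = 0.228\<close> is below 1/2, more than half of the main term
    survives, and \<open>2 / r\<close> becomes the cotype constant.\<close>
  define r :: real where "r = 1 / 1000000"
  have mean_U: "mean m (U \<epsilon>) = (\<Sum>j<n. \<epsilon> j * mean m (u j))" for \<epsilon>
    by (simp add: U_def[abs_def] mean_sum mean_cmult)
  have bal_lin: "balanced k A' (\<lambda>p. r * (\<Sum>j<n. \<epsilon> j * g j p))" if "\<And>j. j < n \<Longrightarrow> balanced k A' (g j)" for k A' g \<epsilon>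
    using that
  proof (induction k arbitrary: A' g)
    case (Suc k)
    then show ?case
      by (auto simp: mean_cmult mean_sum intro!: sum.cong)
  qed simp
  have single: "r^2 * mean m (\<lambda>p. w p * (U \<epsilon> p)^2) - 2000000000 * r^4 * (Z * (mean m (U \<epsilon>))^4 + defect m A w (U \<epsilon>)) \<le> r * N \<epsilon>" for \<epsilon>
  proof -
    \<comment> \<open>Undoes the minimising lift: \<open>w p * U \<epsilon> p\<close> contains the
      Haar sums of the \<open>b j\<close>, which are replaced by that of
      \<open>c \<epsilon>\<close>. All coefficients remain supported in \<open>A\<close>.\<close>
    define e where "e = (\<lambda>k i. r * (c \<epsilon> k i + (\<Sum>j<n. - \<epsilon> j * b j k i)))"
    have e0: "e k i = 0" if "\<not> A k i" for k i using c[OF that] b(1)[OF that] by (simp add: e_def)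
    have bal': "balanced m A (\<lambda>p. r * U \<epsilon> p)" unfolding U_def by (rule bal_lin) (rule bal)
    have pt: "w p * (r * U \<epsilon> p) + 0 + synth m e p = r * ((\<Sum>j<n. \<epsilon> j * x j p) + synth m (c \<epsilon>) p)" for p
    proof -
      have "w p * U \<epsilon> p = (\<Sum>j<n. \<epsilon> j * f j p)"
        using w(1)[of p] by (simp add: U_def u_def sum_distrib_left)
      moreover have "synth m e p = r * (synth m (c \<epsilon>) p + (\<Sum>j<n. - \<epsilon> j * synth m (b j) p))"
        unfolding e_def synth_cmult synth_add synth_sum ..
      ultimately show ?thesis
        by (simp add: f_def sum.distrib sum_negf algebra_simps)
    qed
    have "mean m (\<lambda>p. w p * (r * U \<epsilon> p)^2) + bellman Z (mean m (\<lambda>p. r * U \<epsilon> p)) 0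
      \<le> mean m (\<lambda>p. \<bar>w p * (r * U \<epsilon> p) + 0 + synth m e p\<bar>) + 2000000000 * defect m A w (\<lambda>p. r * U \<epsilon> p)"
      unfolding Z_def by (rule quotient_norm_lower_bound) (use w e0 bal' in auto)
    moreover have "mean m (\<lambda>p. \<bar>w p * (r * U \<epsilon> p) + 0 + synth m e p\<bar>) = r * N \<epsilon>"
      unfolding pt N_def abs_mult mean_cmult by (simp add: r_def)
    moreover have "mean m (\<lambda>p. w p * (r * U \<epsilon> p)^2) = r^2 * mean m (\<lambda>p. w p * (U \<epsilon> p)^2)"
      unfolding mean_cmult[symmetric] by (simp add: power_mult_distrib algebra_simps)
    moreover have "- 2000000000 * Z * (r * mean m (U \<epsilon>))^4 \<le> bellman Z (mean m (\<lambda>p. r * U \<epsilon> p)) 0"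
      using bellman_zero[OF Z, of "r * mean m (U \<epsilon>)"] by (simp add: mean_cmult)
    ultimately show ?thesis
      by (simp add: defect_cmult power_mult_distrib algebra_simps)
  qed
  define W where "W = mean m w"
  have avg: "r^2 * mean m (\<lambda>p. w p * (\<Sum>j<n. (u j p)^2)) - 2000000000 * r^4 * (114 * W) \<le> r * sign_average n N"
  proof -
    have "sign_average n (\<lambda>\<epsilon>. mean m (\<lambda>p. w p * (U \<epsilon> p)^2)) = mean m (\<lambda>p. w p * (\<Sum>j<n. (u j p)^2))"
    proof -
      have "sign_average n (\<lambda>\<epsilon>. mean m (\<lambda>p. g \<epsilon> p)) = mean m (\<lambda>p. sign_average n (\<lambda>\<epsilon>. g \<epsilon> p))" for g
        by (simp add: sign_average_def mean_eq_sum sum_divide_distrib sum.swap[of _ "sign_vectors n"] mult.commute)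
      then show ?thesis by (simp add: sign_average_cmult sign_average_square U_def)
    qed
    moreover have "sign_average n (\<lambda>\<epsilon>. Z * (mean m (U \<epsilon>))^4 + defect m A w (U \<epsilon>)) \<le> 114 * W"
    proof -
      define P where "P = (\<Sum>j<n. (mean m (u j))^2)"
      have P: "0 \<le> P" "P \<le> 1" unfolding P_def by (auto intro!: sum_nonneg sum_square_mean_le u_le)
      have "sign_average n (\<lambda>\<epsilon>. (mean m (U \<epsilon>))^4) \<le> 3 * P^2"
        unfolding mean_U P_def by (rule sign_average_fourth)
      also have "P^2 \<le> 1" using P by (simp add: power_le_one)
      finally have "Z * sign_average n (\<lambda>\<epsilon>. (mean m (U \<epsilon>))^4) \<le> Z * 3" using Z by (intro mult_left_mono) auto
      moreover have "sign_average n (\<lambda>\<epsilon>. defect m A w (U \<epsilon>)) \<le> 3 * (38 * W - Z * (33 + 4 * P))"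
        unfolding U_def W_def Z_def P_def by (rule sign_average_defect) (use w u_le bal in auto)
      moreover have "0 \<le> Z * P" using Z P by simp
      \<comment> \<open>The unspent \<open>99 * Z\<close> of the potential pays for the
        \<open>3 * Z\<close> lost at the root through \<open>bellman_zero\<close>.\<close>
      moreover have "3 * (38 * W - Z * (33 + 4 * P)) = 114 * W - 99 * Z - 12 * (Z * P)" by (simp add: algebra_simps)
      ultimately show ?thesis unfolding sign_average_add sign_average_cmult using Z by linarith
    qed
    moreover have "sign_average n (\<lambda>\<epsilon>. r^2 * mean m (\<lambda>p. w p * (U \<epsilon> p)^2) +
        (- 2000000000 * r^4) * (Z * (mean m (U \<epsilon>))^4 + defect m A w (U \<epsilon>))) \<le> sign_average n (\<lambda>\<epsilon>. r * N \<epsilon>)"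
      using single by (intro sign_average_mono) simp
    ultimately show ?thesis
      unfolding sign_average_add[of n "\<lambda>\<epsilon>. r^2 * mean m (\<lambda>p. w p * (U \<epsilon> p)^2)"] sign_average_cmult by (simp add: r_def power_divide)
  qed
  have "W - \<eta> \<le> mean m (\<lambda>p. w p * (\<Sum>j<n. (u j p)^2))"
  proof -
    have "W - \<eta> = mean m (\<lambda>p. w p - \<eta>)" by (simp add: mean_diff W_def)
    also have "\<dots> \<le> mean m (\<lambda>p. w p * (\<Sum>j<n. (u j p)^2))"
    proof (rule mean_mono)
      fix p
      have "w p * (\<Sum>j<n. (u j p)^2) = w p - \<eta> * (\<eta> / w p)"
        unfolding u_sq using w(1)[of p] by (simp add: field_simps power2_eq_square)
      moreover have "\<eta> * (\<eta> / w p) \<le> \<eta> * 1" using w(1)[of p] w_ge[of p] \<eta> by (intro mult_left_mono) auto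
      ultimately show "w p - \<eta> \<le> w p * (\<Sum>j<n. (u j p)^2)" by simp
    qed
    finally show ?thesis .
  qed
  moreover have "0 \<le> sign_average n N"
    unfolding sign_average_def N_def mean_eq_sum by (intro divide_nonneg_nonneg sum_nonneg) auto
  ultimately have WN: "W \<le> 2000000 * sign_average n N + 2 * \<eta>"
    using avg \<eta> by (simp add: r_def power_divide)
  have "L2_set (\<lambda>j. mean m (\<lambda>p. \<bar>f j p\<bar>)) {..<n} \<le> mean m (\<lambda>p. L2_set (\<lambda>j. \<bar>f j p\<bar>) {..<n})"
    by (rule L2_set_mean_le)
  also have "\<dots> \<le> W"
    unfolding W_def w_def L2_set_def by (intro mean_mono real_sqrt_le_mono) simp
  also note WN
  finally show ?thesis using b(1) by (intro that[of b]) (auto simp: f_def N_def[abs_def])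
qed

section \<open>Transfer to $L_1$\<close>

definition cell :: "nat \<Rightarrow> nat \<Rightarrow> real set" where
  "cell m p = {real p / 2^m ..< (real p + 1) / 2^m}"

lemma cell_iff: "t \<in> cell m p \<longleftrightarrow> \<lfloor>t * 2^m\<rfloor> = int p"
  by (simp add: cell_def floor_eq_iff divide_le_eq less_divide_eq)

lemma cell_subset: "p < 2^m \<Longrightarrow> cell m p \<subseteq> {0..<1}"
proof -
  assume "p < 2^m"
  then have "real p + 1 \<le> 2^m" by (metis Suc_leI add.commute of_nat_Suc of_nat_le_iff of_nat_numeral of_nat_power)
  then have "(real p + 1) / 2^m \<le> 1" by simp
  then show ?thesis by (auto simp: cell_def intro: order_trans[rotated])
qed

lemma cell_exists:
  assumes "t \<in> {0..<1}"
  obtains p where "p < 2^m" "t \<in> cell m p"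
proof
  have "0 \<le> t * 2^m" "t * 2^m < 2^m" using assms by auto
  then have "0 \<le> \<lfloor>t * 2^m\<rfloor>" "\<lfloor>t * 2^m\<rfloor> < 2^m" by (auto simp: floor_less_iff)
  then show "nat \<lfloor>t * 2^m\<rfloor> < 2^m" "t \<in> cell m (nat \<lfloor>t * 2^m\<rfloor>)"
    by (auto simp: cell_iff nat_less_iff)
qed

lemma cell_coarsen:
  assumes "t \<in> cell (k + l) p"
  shows "t \<in> cell k q \<longleftrightarrow> p div 2^l = q"
proof -
  have "t * 2^k = (t * 2^(k + l)) / real_of_int (2^l)" by (simp add: power_add)
  then have "\<lfloor>t * 2^k\<rfloor> = \<lfloor>t * 2^(k + l)\<rfloor> div 2^l" using floor_divide_real_eq_div[of "2^l" "t * 2^(k + l)"] by simp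
  also have "\<dots> = int (p div 2^l)" using assms by (simp add: cell_iff zdiv_int)
  finally show ?thesis by (simp add: cell_iff)
qed

lemma dyadic_intervals_eq: "dyadic_intervals = {cell k i | k i. i < 2^k}"
proof (intro set_eqI iffI)
  fix I assume "I \<in> dyadic_intervals"
  then obtain i n where I: "I = {(real i - 1) / 2^n ..< real i / 2^n}" "1 \<le> i" "i \<le> 2^n"
    by (auto simp: dyadic_intervals_def)
  \<comment> \<open>Dyadic intervals are numbered from 1, cells from 0.\<close>
  then have "I = cell n (i - 1)" "i - 1 < 2^n" by (auto simp: cell_def of_nat_diff)
  then show "I \<in> {cell k i | k i. i < 2^k}" by blast
next
  fix I assume "I \<in> {cell k i | k i. i < 2^k}"
  then obtain k i where "I = cell k i" "i < 2^k" by blast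
  then have "I = {(real (Suc i) - 1) / 2^k ..< real (Suc i) / 2^k} \<and> 1 \<le> Suc i \<and> Suc i \<le> 2^k"
    by (auto simp: cell_def add.commute)
  then show "I \<in> dyadic_intervals" unfolding dyadic_intervals_def by blast
qed

lemma haar_cell: "haar (cell k i) t = indicator (cell (Suc k) (2 * i)) t - indicator (cell (Suc k) (2 * i + 1)) t"
proof -
  have lt: "real i / 2^k < (real i + 1) / 2^k" by (simp add: divide_strict_right_mono)
  have mid: "(real i / 2^k + (real i + 1) / 2^k) / 2 = (2 * real i + 1) / 2^Suc k" by (simp add: field_simps)
  have ends: "real i / 2^k = 2 * real i / 2^Suc k" "(real i + 1) / 2^k = (2 * real i + 2) / 2^Suc k"
    by (simp_all add: field_simps)
  have "left_half (cell k i) = cell (Suc k) (2 * i)" "right_half (cell k i) = cell (Suc k) (2 * i + 1)"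
    unfolding cell_def halves_of_interval[OF lt] mid unfolding ends by (simp_all add: add.commute)
  then show ?thesis by (simp add: haar_def)
qed

definition stepf :: "nat \<Rightarrow> (nat \<Rightarrow> real) \<Rightarrow> real \<Rightarrow> real" where
  "stepf m a t = (\<Sum>p<2^m. a p * indicator (cell m p) t)"

lemma stepf_in:
  assumes "t \<in> cell m p" "p < 2^m"
  shows "stepf m a t = a p"
proof -
  have "a q * indicator (cell m q) t = (if q = p then a q else 0)" for q
    using assms(1) by (auto simp: cell_iff indicator_def)
  then show ?thesis using assms(2) by (simp add: stepf_def)
qed

lemma stepf_out: "t \<notin> {0..<1} \<Longrightarrow> stepf m a t = 0"
  using cell_subset unfolding stepf_def by (intro sum.neutral) (fastforce simp: indicator_def)

lemma integral_cell:
  assumes "p < 2^m"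
  shows "has_bochner_integral unit_interval_measure (indicator (cell m p) :: real \<Rightarrow> real) (1 / 2^m)"
proof -
  have sub: "cell m p \<subseteq> {0..1}" using cell_subset[OF assms] by auto
  have le: "real p / 2^m \<le> (real p + 1) / 2^m" by (simp add: divide_right_mono)
  have "emeasure unit_interval_measure (cell m p) = emeasure lebesgue (cell m p)"
    using sub by (intro emeasure_restrict_space) auto
  also have "\<dots> = ennreal (1 / 2^m)"
    using le by (simp add: cell_def diff_divide_distrib[symmetric])
  finally have e: "emeasure unit_interval_measure (cell m p) = ennreal (1 / 2^m)" .
  then have "measure unit_interval_measure (cell m p) = 1 / 2^m" by (simp add: measure_def)
  moreover have "cell m p \<in> sets unit_interval_measure"
    using sub by (auto simp: sets_restrict_space_iff cell_def)
  ultimately show ?thesis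
    using has_bochner_integral_real_indicator[of "cell m p" unit_interval_measure] e by simp
qed

lemma integral_stepf: "has_bochner_integral unit_interval_measure (stepf m a) (mean m a)"
proof -
  have "has_bochner_integral unit_interval_measure (stepf m a) (\<Sum>p<2^m. a p * (1 / 2^m))"
    unfolding stepf_def[abs_def]
    by (intro has_bochner_integral_sum has_bochner_integral_mult_right integral_cell) auto
  then show ?thesis by (simp add: mean_eq_sum sum_divide_distrib)
qed

lemma integrable_stepf: "integrable unit_interval_measure (stepf m a)"
  using integral_stepf has_bochner_integral_iff by blast

lemma stepf_eqI:
  assumes "\<And>p t. p < 2^m \<Longrightarrow> t \<in> cell m p \<Longrightarrow> f t = a p" "\<And>t. t \<notin> {0..<1} \<Longrightarrow> f t = 0"
  shows "stepf m a t = f t"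
  using assms stepf_in stepf_out cell_exists by metis

lemma stepf_refine: "stepf (m + l) (\<lambda>p. a (p div 2^l)) t = stepf m a t"
proof (rule stepf_eqI)
  fix p t assume *: "p < 2^(m + l)" "t \<in> cell (m + l) p"
  then have "p div 2^l < 2^m" by (simp add: power_add less_mult_imp_div_less)
  moreover have "t \<in> cell m (p div 2^l)" using cell_coarsen[OF *(2)] by simp
  ultimately show "stepf m a t = a (p div 2^l)" by (intro stepf_in)
qed (rule stepf_out)

section \<open>Haar functions as arrays\<close>

definition unit_coeff :: "nat \<Rightarrow> nat \<Rightarrow> nat \<Rightarrow> nat \<Rightarrow> real" where
  "unit_coeff k i k' i' = (if k' = k \<and> i' = i then 1 else 0)"

text \<open>Reconciles the recursion of \<open>synth\<close> with the left-to-right numbering: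
  \<open>q\<close> is the cell of level \<open>Suc k\<close> containing cell \<open>p\<close>, and
  \<open>2 * i\<close>, \<open>2 * i + 1\<close> are the halves of node
  \<open>(k, i)\<close>.\<close>

lemma synth_unit_coeff:
  assumes "k < m" "i < 2^k" "p < 2^m"
  shows "synth m (unit_coeff k i) p = (let q = p div 2^(m - Suc k) in if q = 2 * i then 1 else if q = 2 * i + 1 then -1 else 0)"
  using assms
proof (induction m arbitrary: k i p)
  case (Suc m)
  show ?case
  proof (cases k)
    case 0
    then have "i = 0" using Suc.prems(2) by simp
    have "left_sub (unit_coeff 0 0) = (\<lambda>k i. 0)" "right_sub (unit_coeff 0 0) = (\<lambda>k i. 0)"
      by (simp_all add: fun_eq_iff left_sub_def right_sub_def unit_coeff_def)
    moreover have "p div 2^m = (if p < 2^m then 0 else 1)"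
      using Suc.prems(3) by (auto intro!: div_nat_eqI)
    ultimately show ?thesis by (simp add: 0 \<open>i = 0\<close> synth_zero unit_coeff_def[of 0 0 0 0])
  next
    case (Suc k')
    have k': "k' < m" using Suc Suc.prems(1) by simp
    define l where "l = m - Suc k'"
    have m: "m = k' + 1 + l" using k' by (simp add: l_def)
    have root: "unit_coeff k i 0 0 = 0" by (simp add: unit_coeff_def Suc)
    have pow: "(2::nat)^m = 2^(k' + 1) * 2^l" by (simp add: m power_add)
    show ?thesis
    proof (cases "i < 2^k'")
      case i: True
      have "left_sub (unit_coeff k i) = unit_coeff k' i" by (simp add: fun_eq_iff left_sub_def unit_coeff_def Suc)
      moreover have "synth m (right_sub (unit_coeff k i)) q = synth m (\<lambda>k i. 0) q" if "q < 2^m" for q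
        using that i by (intro synth_cong) (auto simp: right_sub_def unit_coeff_def Suc)
      moreover have "2^(k' + 1) \<le> p div 2^l" if "\<not> p < 2^m"
      proof -
        have "2^(k' + 1) * 2^l \<le> p" using that pow by simp
        then show ?thesis using div_le_mono[of "2^(k' + 1) * 2^l" p "2^l"] by simp
      qed
      ultimately show ?thesis
        using Suc.IH[OF k' i, of p] Suc.prems(3) i root by (auto simp: Suc Let_def l_def synth_zero)
    next
      case False
      define i' where "i' = i - 2^k'"
      have i': "i = 2^k' + i'" "i' < 2^k'" using False Suc.prems(2) Suc by (auto simp: i'_def)
      have "right_sub (unit_coeff k i) = unit_coeff k' i'"
        by (simp add: fun_eq_iff right_sub_def unit_coeff_def Suc i'(1))
      moreover have "synth m (left_sub (unit_coeff k i)) q = synth m (\<lambda>k i. 0) q" if "q < 2^m" for q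
        using that False by (intro synth_cong) (auto simp: left_sub_def unit_coeff_def Suc)
      moreover have "p div 2^l < 2^(k' + 1)" if "p < 2^m"
        using that unfolding pow by (simp add: less_mult_imp_div_less)
      moreover have "p div 2^l = 2^(k' + 1) + (p - 2^m) div 2^l" if "\<not> p < 2^m"
      proof -
        have "p = 2^(k' + 1) * 2^l + (p - 2^m)" using that pow by simp
        then have "p div 2^l = (2^(k' + 1) * 2^l + (p - 2^m)) div 2^l" by simp
        also have "\<dots> = 2^(k' + 1) + (p - 2^m) div 2^l" by simp
        finally show ?thesis .
      qed
      ultimately show ?thesis
        using Suc.IH[OF k' i'(2), of "p - 2^m"] Suc.prems(3) i' root by (auto simp: Suc Let_def l_def synth_zero)
    qed
  qed
qed simp

lemma stepf_synth_unit:
  assumes "k < m" "i < 2^k"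
  shows "stepf m (synth m (unit_coeff k i)) t = haar (cell k i) t"
proof (rule stepf_eqI)
  fix p t assume *: "p < 2^m" "t \<in> cell m p"
  have "t \<in> cell (Suc k) q \<longleftrightarrow> p div 2^(m - Suc k) = q" for q
    by (rule cell_coarsen) (use * assms in simp)
  then show "haar (cell k i) t = synth m (unit_coeff k i) p"
    unfolding synth_unit_coeff[OF assms *(1)] haar_cell by (simp add: Let_def)
next
  fix t :: real assume "t \<notin> {0..<1}"
  moreover have "2 * i + 1 < 2^Suc k" using assms(2) by simp
  ultimately show "haar (cell k i) t = 0"
    unfolding haar_cell using cell_subset[of "2 * i" "Suc k"] cell_subset[of "2 * i + 1" "Suc k"] by (auto simp: indicator_def)
qed

section \<open>Density of dyadic step functions\<close>

text \<open>Only indicators need an idea: the set is approximated from outside by an open set, and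
  this from inside by the cells it contains.\<close>

lemma step_dense_function:
  assumes "integrable unit_interval_measure f" "0 < (e::real)"
  shows "\<exists>m a. integral\<^sup>L unit_interval_measure (\<lambda>t. \<bar>f t - stepf m a t\<bar>) < e"
  using assms
proof (induction arbitrary: e rule: integrable_induct)
  case (base A c)
  let ?M = unit_interval_measure
  have A: "A \<in> sets lebesgue" "A \<subseteq> {0..1}" using base(1) by (auto simp: sets_restrict_space_iff)
  define e' where "e' = e / (2 * (\<bar>c\<bar> + 1))"
  have e': "0 < e'" using base(3) by (simp add: e'_def)
  obtain T where T: "open T" "A \<subseteq> T" "T - A \<in> lmeasurable" "emeasure lebesgue (T - A) < ennreal e'"
    using sets_lebesgue_outer_open[OF A(1) e'] by blast
  define a where "a m p = (if cell m p \<subseteq> T then c else 0)" for m p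
  have ind: "integrable ?M (indicator S :: real \<Rightarrow> real)" if "S \<in> sets lebesgue" for S
  proof (rule Bochner_Integration.integrable_bound)
    show "integrable ?M (\<lambda>_. 1 :: real)" by simp
    have "indicator S \<in> borel_measurable lebesgue" using that by (rule borel_measurable_indicator)
    then show "(indicator S :: real \<Rightarrow> real) \<in> borel_measurable ?M" by (rule measurable_restrict_space1)
  qed (auto simp: indicator_def)
  have Tl: "T \<in> sets lebesgue" "T - A \<in> sets lebesgue" using T(1,3) by auto
  have "(\<lambda>m. integral\<^sup>L ?M (\<lambda>t. \<bar>indicator T t * c - stepf m (a m) t\<bar>)) \<longlonglongrightarrow> integral\<^sup>L ?M (\<lambda>t. 0)"
  proof (rule integral_dominated_convergence[where w = "\<lambda>_. \<bar>c\<bar> * 2"])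
    show "(\<lambda>t. \<bar>indicator T t * c - stepf m (a m) t\<bar>) \<in> borel_measurable ?M" for m
      using ind[OF Tl(1)] integrable_stepf[of m "a m"] by (intro borel_measurable_integrable integrable_abs Bochner_Integration.integrable_diff integrable_mult_left) auto
    have "\<bar>stepf m (a m) t\<bar> \<le> \<bar>c\<bar>" for m t
    proof (cases "t \<in> {0..<1}")
      case True
      then obtain p where "p < 2^m" "t \<in> cell m p" using cell_exists by blast
      then show ?thesis by (simp add: stepf_in a_def)
    qed (simp add: stepf_out)
    moreover have "\<bar>indicator T t * c\<bar> \<le> \<bar>c\<bar>" for t by (simp add: indicator_def)
    ultimately have "\<bar>indicator T t * c - stepf m (a m) t\<bar> \<le> \<bar>c\<bar> * 2" for m t
      using abs_triangle_ineq4[of "indicator T t * c" "stepf m (a m) t"] by (smt (verit))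
    then show "AE t in ?M. norm \<bar>indicator T t * c - stepf m (a m) t\<bar> \<le> \<bar>c\<bar> * 2" for m by simp
    have "(\<lambda>m. \<bar>indicator T t * c - stepf m (a m) t\<bar>) \<longlonglongrightarrow> 0" if t: "t \<in> {0..<1}" for t
    proof (rule tendsto_eventually)
      show "\<forall>\<^sub>F m in sequentially. \<bar>indicator T t * c - stepf m (a m) t\<bar> = 0"
      proof (cases "t \<in> T")
        case True
        then obtain r where r: "0 < r" "ball t r \<subseteq> T" using T(1) open_contains_ball by blast
        obtain N where N: "(1/2)^N < r" using real_arch_pow_inv[of r "1/2"] r by auto
        have "cell m p \<subseteq> T" if "N \<le> m" "t \<in> cell m p" for m p
        proof
          fix s assume s: "s \<in> cell m p"
          have "\<bar>t - s\<bar> < (1/2)^m"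
            using s that(2) unfolding cell_def by (auto simp: power_divide add_divide_distrib abs_less_iff)
          also have "(1/2)^m \<le> (1/2::real)^N" using that(1) by (intro power_decreasing) auto
          finally show "s \<in> T" using N r(2) by (auto simp: dist_real_def)
        qed
        then have "indicator T t * c - stepf m (a m) t = 0" if "N \<le> m" for m
          using that True cell_exists[OF t, of m] by (metis (no_types, lifting) a_def stepf_in indicator_simps(1) mult_1 diff_self)
        then show ?thesis unfolding eventually_sequentially by auto
      next
        case False
        have "stepf m (a m) t = 0" for m
        proof -
          obtain p where "p < 2^m" "t \<in> cell m p" using cell_exists[OF t] by blast
          then show ?thesis using False by (auto simp: stepf_in a_def)
        qed
        then show ?thesis using False by simp
      qed
    qed
    \<comment> \<open>No cell reaches the endpoint 1, which is a null set.\<close>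
    moreover have "AE t in ?M. t \<noteq> 1"
    proof -
      have "AE t in lebesgue. t \<noteq> (1::real)" by (rule AE_completion) (rule AE_lborel_singleton)
      then show ?thesis by (auto simp: AE_restrict_space_iff)
    qed
    ultimately show "AE t in ?M. (\<lambda>m. \<bar>indicator T t * c - stepf m (a m) t\<bar>) \<longlonglongrightarrow> 0"
      by (elim AE_mp) (auto intro!: AE_I2)
  qed auto
  moreover have "0 < e / 2" using base(3) by simp
  ultimately have "\<forall>\<^sub>F m in sequentially. integral\<^sup>L ?M (\<lambda>t. \<bar>indicator T t * c - stepf m (a m) t\<bar>) < e / 2"
    using order_tendstoD(2) by fastforce
  then obtain m where m: "integral\<^sup>L ?M (\<lambda>t. \<bar>indicator T t * c - stepf m (a m) t\<bar>) < e / 2"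
    using eventually_happens trivial_limit_sequentially by blast
  have TA: "integral\<^sup>L ?M (indicator (T - A)) \<le> e'"
  proof -
    have "integral\<^sup>L ?M (indicator (T - A)) = integral\<^sup>L lebesgue (\<lambda>t. indicator {0..1} t *\<^sub>R indicator (T - A) t :: real)"
      by (rule integral_restrict_space) simp
    also have "\<dots> \<le> integral\<^sup>L lebesgue (indicator (T - A))"
      using T(3) by (intro integral_mono' integrable_real_indicator) (auto simp: indicator_def fmeasurable_def)
    also have "\<dots> = measure lebesgue (T - A)" by simp
    also have "\<dots> \<le> e'" 
      using T(3,4) e' by (simp add: emeasure_eq_measure2 ennreal_less_iff)
    finally show ?thesis .
  qed
  have "integral\<^sup>L ?M (\<lambda>t. \<bar>indicator A t *\<^sub>R c - stepf m (a m) t\<bar>)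
    \<le> integral\<^sup>L ?M (\<lambda>t. \<bar>c\<bar> * indicator (T - A) t + \<bar>indicator T t * c - stepf m (a m) t\<bar>)"
  proof (rule integral_mono)
    show "integrable ?M (\<lambda>t. \<bar>indicator A t *\<^sub>R c - stepf m (a m) t\<bar>)"
      using ind[OF A(1)] integrable_stepf by (auto intro!: integrable_abs)
    show "integrable ?M (\<lambda>t. \<bar>c\<bar> * indicator (T - A) t + \<bar>indicator T t * c - stepf m (a m) t\<bar>)"
      using ind[OF Tl(1)] ind[OF Tl(2)] integrable_stepf by (intro Bochner_Integration.integrable_add integrable_abs Bochner_Integration.integrable_diff) auto
    show "\<bar>indicator A t *\<^sub>R c - stepf m (a m) t\<bar> \<le> \<bar>c\<bar> * indicator (T - A) t + \<bar>indicator T t * c - stepf m (a m) t\<bar>" for t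
      using T(2) by (auto simp: indicator_def)
  qed
  also have "\<dots> = \<bar>c\<bar> * integral\<^sup>L ?M (indicator (T - A)) + integral\<^sup>L ?M (\<lambda>t. \<bar>indicator T t * c - stepf m (a m) t\<bar>)"
    using ind[OF Tl(1)] ind[OF Tl(2)] integrable_stepf by (subst Bochner_Integration.integral_add) auto
  also have "\<dots> < \<bar>c\<bar> * e' + e / 2"
    using TA m by (intro add_le_less_mono mult_left_mono) auto
  also have "\<dots> \<le> e"
  proof -
    have "\<bar>c\<bar> * e' \<le> (\<bar>c\<bar> + 1) * e'" using e' by simp
    also have "\<dots> = e / 2" by (simp add: e'_def field_simps)
    finally show ?thesis by simp
  qed
  finally show ?case by blast
next
  case (add f g)
  let ?M = unit_interval_measure
  obtain m a where f: "integral\<^sup>L ?M (\<lambda>t. \<bar>f t - stepf m a t\<bar>) < e / 2" using add.IH(1)[of "e/2"] add.prems by auto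
  obtain k b where g: "integral\<^sup>L ?M (\<lambda>t. \<bar>g t - stepf k b t\<bar>) < e / 2" using add.IH(2)[of "e/2"] add.prems by auto
  define h where "h p = a (p div 2^k) + b (p div 2^m)" for p
  have h: "stepf (m + k) h t = stepf m a t + stepf k b t" for t
  proof -
    have "stepf (m + k) h t = stepf (m + k) (\<lambda>p. a (p div 2^k)) t + stepf (k + m) (\<lambda>p. b (p div 2^m)) t"
      by (simp add: stepf_def h_def sum.distrib distrib_right add.commute)
    then show ?thesis by (simp add: stepf_refine)
  qed
  have "integral\<^sup>L ?M (\<lambda>t. \<bar>f t + g t - stepf (m + k) h t\<bar>)
    \<le> integral\<^sup>L ?M (\<lambda>t. \<bar>f t - stepf m a t\<bar> + \<bar>g t - stepf k b t\<bar>)"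
    using add.hyps integrable_stepf unfolding h by (intro integral_mono) (auto intro!: integrable_abs)
  also have "\<dots> = integral\<^sup>L ?M (\<lambda>t. \<bar>f t - stepf m a t\<bar>) + integral\<^sup>L ?M (\<lambda>t. \<bar>g t - stepf k b t\<bar>)"
    using add.hyps integrable_stepf by (intro Bochner_Integration.integral_add) auto
  also have "\<dots> < e" using f g by simp
  finally show ?case by blast
next
  case (lim f s)
  let ?M = unit_interval_measure
  have "(\<lambda>i. integral\<^sup>L ?M (\<lambda>t. \<bar>f t - s i t\<bar>)) \<longlonglongrightarrow> integral\<^sup>L ?M (\<lambda>t. 0)"
  proof (rule integral_dominated_convergence[where w = "\<lambda>t. 3 * \<bar>f t\<bar>"])
    show "(\<lambda>t. \<bar>f t - s i t\<bar>) \<in> borel_measurable ?M" for i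
      using lim by (intro borel_measurable_integrable integrable_abs Bochner_Integration.integrable_diff) auto
    show "AE t in ?M. (\<lambda>i. \<bar>f t - s i t\<bar>) \<longlonglongrightarrow> 0"
    proof (rule AE_I2)
      fix t assume "t \<in> space ?M"
      then have "(\<lambda>i. \<bar>f t - s i t\<bar>) \<longlonglongrightarrow> \<bar>f t - f t\<bar>" using lim by (intro tendsto_intros) auto
      then show "(\<lambda>i. \<bar>f t - s i t\<bar>) \<longlonglongrightarrow> 0" by simp
    qed
    show "AE t in ?M. norm \<bar>f t - s i t\<bar> \<le> 3 * \<bar>f t\<bar>" for i
    proof (rule AE_I2)
      fix t assume "t \<in> space ?M"
      then have "norm (s i t) \<le> 2 * norm (f t)" using lim by auto
      then show "norm \<bar>f t - s i t\<bar> \<le> 3 * \<bar>f t\<bar>" by auto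
    qed
  qed (use lim in auto)
  moreover have "0 < e / 2" using lim.prems by simp
  ultimately have "\<forall>\<^sub>F i in sequentially. integral\<^sup>L ?M (\<lambda>t. \<bar>f t - s i t\<bar>) < e / 2"
    using order_tendstoD(2) by fastforce
  then obtain i where i: "integral\<^sup>L ?M (\<lambda>t. \<bar>f t - s i t\<bar>) < e / 2"
    using eventually_happens trivial_limit_sequentially by blast
  obtain m a where a: "integral\<^sup>L ?M (\<lambda>t. \<bar>s i t - stepf m a t\<bar>) < e / 2"
    using lim.IH[of "e/2" i] lim.prems by auto
  have "integral\<^sup>L ?M (\<lambda>t. \<bar>f t - stepf m a t\<bar>) \<le> integral\<^sup>L ?M (\<lambda>t. \<bar>f t - s i t\<bar> + \<bar>s i t - stepf m a t\<bar>)"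
    using lim integrable_stepf by (intro integral_mono) (auto intro!: integrable_abs)
  also have "\<dots> = integral\<^sup>L ?M (\<lambda>t. \<bar>f t - s i t\<bar>) + integral\<^sup>L ?M (\<lambda>t. \<bar>s i t - stepf m a t\<bar>)"
    using lim integrable_stepf by (intro Bochner_Integration.integral_add) auto
  also have "\<dots> < e" using i a by simp
  finally show ?case by blast
qed

section \<open>Step functions and Haar spans in the space \<open>L1\<close>\<close>

lift_definition step :: "nat \<Rightarrow> (nat \<Rightarrow> real) \<Rightarrow> L1" is stepf
  by (simp add: L1_rel_def integrable_stepf)

lemma step_eqI: "(\<And>t. stepf m a t = stepf k b t) \<Longrightarrow> step m a = step k b"
  by transfer (simp add: L1_rel_def integrable_stepf)

lemma step_cong: "(\<And>p. p < 2^m \<Longrightarrow> a p = b p) \<Longrightarrow> step m a = step m b"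
  by (rule step_eqI) (simp add: stepf_def)

lemma step_refine: "step (m + l) (\<lambda>p. a (p div 2^l)) = step m a"
  by (rule step_eqI) (rule stepf_refine)

lemma step_add: "step m (\<lambda>p. a p + b p) = step m a + step m b"
proof transfer
  fix m a b
  have "stepf m (\<lambda>p. a p + b p) = (\<lambda>t. stepf m a t + stepf m b t)"
    by (simp add: fun_eq_iff stepf_def sum.distrib distrib_right)
  then show "L1_rel (stepf m (\<lambda>p. a p + b p)) (\<lambda>t. stepf m a t + stepf m b t)"
    by (simp add: L1_rel_def integrable_stepf)
qed

lemma step_scaleR: "step m (\<lambda>p. r * a p) = r *\<^sub>R step m a"
proof transfer
  fix m r a
  have "stepf m (\<lambda>p. r * a p) = (\<lambda>t. r * stepf m a t)"
    by (intro ext) (simp only: stepf_def sum_distrib_left mult.assoc)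
  then show "L1_rel (stepf m (\<lambda>p. r * a p)) (\<lambda>t. r * stepf m a t)"
    by (simp add: L1_rel_def integrable_stepf)
qed

lemma step_zero: "step m (\<lambda>p. 0) = 0"
  using step_scaleR[of m 0 "\<lambda>p. 0"] by simp

lemma step_sum: "step m (\<lambda>p. \<Sum>a\<in>S. f a p) = (\<Sum>a\<in>S. step m (f a))"
  by (induction S rule: infinite_finite_induct) (simp_all add: step_zero step_add)

lemma norm_step: "norm (step m a) = mean m (\<lambda>p. \<bar>a p\<bar>)"
proof -
  have "\<bar>stepf m a t\<bar> = stepf m (\<lambda>p. \<bar>a p\<bar>) t" for t
    by (rule sym, rule stepf_eqI) (auto simp: stepf_in stepf_out)
  then have "integral\<^sup>L unit_interval_measure (\<lambda>t. \<bar>stepf m a t\<bar>) = mean m (\<lambda>p. \<bar>a p\<bar>)"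
    using integral_stepf[of m "\<lambda>p. \<bar>a p\<bar>"] by (simp add: has_bochner_integral_iff)
  then show ?thesis by (simp add: norm_L1.abs_eq step.abs_eq L1_rel_def integrable_stepf eq_onp_def)
qed

lemma step_dense:
  assumes "0 < e"
  shows "\<exists>m a. norm (z - step m a) < e"
  using assms
proof (transfer fixing: e)
  fix z assume "L1_rel z z" "0 < e"
  then show "\<exists>m a. integral\<^sup>L unit_interval_measure (\<lambda>t. \<bar>z t - stepf m a t\<bar>) < e"
    by (intro step_dense_function) (simp_all add: L1_rel_def)
qed

lemma haar_eq_step:
  assumes "k < m" "i < 2^k"
  shows "haar_L1 (cell k i) = step m (synth m (unit_coeff k i))"
  using stepf_synth_unit[OF assms]
  by (transfer fixing: k m i) (simp add: L1_rel_def integrable_stepf integrable_haar)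

definition node_in :: "real set set \<Rightarrow> nat \<Rightarrow> nat \<Rightarrow> bool" where
  "node_in \<A> k i \<longleftrightarrow> i < 2^k \<and> cell k i \<in> \<A>"

text \<open>Only the finitely many nodes of level below \<open>m\<close> are seen by
  \<open>synth m\<close>, so \<open>c\<close> may be exchanged for a finite combination of unit
  coefficients.\<close>

lemma step_synth_in_span:
  assumes "\<And>k i. \<not> node_in \<A> k i \<Longrightarrow> c k i = 0"
  shows "step m (synth m c) \<in> span (haar_L1 ` \<A>)"
proof -
  define T where "T = Sigma {..<m} (\<lambda>k. {..<2^k :: nat})"
  define c' where "c' = (\<lambda>k' i'. \<Sum>a\<in>T. c (fst a) (snd a) * unit_coeff (fst a) (snd a) k' i')"
  have "c k i = c' k i" if "k < m" "i < 2^k" for k i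
  proof -
    have "c' k i = (\<Sum>a\<in>T. if a = (k, i) then c k i else 0)"
      unfolding c'_def by (intro sum.cong) (auto simp: unit_coeff_def)
    also have "\<dots> = c k i" using that by (simp add: T_def)
    finally show ?thesis by simp
  qed
  then have "step m (synth m c) = step m (synth m c')"
    by (intro step_cong synth_cong) auto
  also have "\<dots> = (\<Sum>a\<in>T. c (fst a) (snd a) *\<^sub>R step m (synth m (unit_coeff (fst a) (snd a))))"
    unfolding c'_def synth_sum[abs_def] step_sum synth_cmult[abs_def] step_scaleR ..
  also have "\<dots> \<in> span (haar_L1 ` \<A>)"
  proof (rule span_sum)
    fix a assume "a \<in> T"
    then have a: "fst a < m" "snd a < 2^fst a" by (auto simp: T_def)
    show "c (fst a) (snd a) *\<^sub>R step m (synth m (unit_coeff (fst a) (snd a))) \<in> span (haar_L1 ` \<A>)"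
    proof (cases "node_in \<A> (fst a) (snd a)")
      case True
      then show ?thesis unfolding haar_eq_step[OF a, symmetric]
        by (intro span_scale span_base) (auto simp: node_in_def)
    next
      case False
      then show ?thesis using assms by (simp add: span_zero)
    qed
  qed
  finally show ?thesis .
qed

text \<open>Stated for all large levels, so that finitely many elements of the span can be written
  at a common one.\<close>

lemma span_haar_is_step:
  assumes "\<A> \<subseteq> dyadic_intervals" "y \<in> span (haar_L1 ` \<A>)"
  shows "\<exists>m0. \<forall>m\<ge>m0. \<exists>c. (\<forall>k i. \<not> node_in \<A> k i \<longrightarrow> c k i = 0) \<and> y = step m (synth m c)"
  using assms(2)
proof (induction rule: span_induct_alt)
  case base
  have "step m (synth m (\<lambda>k i. 0)) = 0" for m
    by (simp add: synth_zero[abs_def] step_zero)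
  then show ?case by metis
next
  case (step r x y)
  then obtain k i where x: "x = haar_L1 (cell k i)" and ki: "cell k i \<in> \<A>" "i < 2^k"
    using assms(1) by (auto simp: dyadic_intervals_eq)
  obtain m0 where m0: "\<And>m. m \<ge> m0 \<Longrightarrow> \<exists>c. (\<forall>k i. \<not> node_in \<A> k i \<longrightarrow> c k i = 0) \<and> y = step m (synth m c)"
    using step.IH by blast
  show ?case
  proof (intro exI[of _ "max m0 (Suc k)"] allI impI)
    fix m assume m: "max m0 (Suc k) \<le> m"
    then obtain c where c: "\<And>k i. \<not> node_in \<A> k i \<Longrightarrow> c k i = 0" "y = step m (synth m c)"
      using m0[of m] by auto
    define c' where "c' = (\<lambda>k' i'. r * unit_coeff k i k' i' + c k' i')"
    have "r *\<^sub>R x + y = step m (synth m c')"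
      using m ki unfolding c'_def synth_add[abs_def] step_add synth_cmult[abs_def] step_scaleR
      by (simp add: x c(2) haar_eq_step)
    moreover have "c' k' i' = 0" if "\<not> node_in \<A> k' i'" for k' i'
      using that ki c(1)[OF that] by (auto simp: c'_def unit_coeff_def node_in_def)
    ultimately show "\<exists>c. (\<forall>k i. \<not> node_in \<A> k i \<longrightarrow> c k i = 0) \<and> r *\<^sub>R x + y = step m (synth m c)"
      by blast
  qed
qed

section \<open>Quotient norms\<close>

definition quotient_norm :: "'a::real_normed_vector set \<Rightarrow> 'a \<Rightarrow> real" where
  "quotient_norm Y x = (INF y\<in>Y. norm (x + y))"

lemma quotient_norm_le: "y \<in> Y \<Longrightarrow> quotient_norm Y x \<le> norm (x + y)"
  unfolding quotient_norm_def by (rule cINF_lower) (auto intro: bdd_belowI[of _ 0])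

lemma quotient_norm_nonneg: "Y \<noteq> {} \<Longrightarrow> 0 \<le> quotient_norm Y x"
  unfolding quotient_norm_def by (rule cINF_greatest) auto

lemma quotient_norm_approx:
  assumes "Y \<noteq> {}" "0 < e"
  obtains y where "y \<in> Y" "norm (x + y) < quotient_norm Y x + e"
proof -
  have "\<exists>y\<in>Y. norm (x + y) < quotient_norm Y x + e"
  proof (rule ccontr)
    assume "\<not> ?thesis"
    then have "quotient_norm Y x + e \<le> (INF y\<in>Y. norm (x + y))"
      using assms(1) by (intro cINF_greatest) (auto simp: not_less)
    then show False using assms(2) by (simp add: quotient_norm_def)
  qed
  then show ?thesis using that by blast
qed

text \<open>Nearly optimal corrections can be taken in \<open>S\<close> itself; for the linear span
  these are finite Haar sums.\<close>

lemma quotient_norm_closure_approx: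
  assumes "S \<noteq> {}" "0 < e"
  obtains y where "y \<in> S" "norm (x + y) < quotient_norm (closure S) x + e"
proof -
  obtain y where y: "y \<in> closure S" "norm (x + y) < quotient_norm (closure S) x + e / 2"
    using quotient_norm_approx[of "closure S" "e / 2" x] assms by auto
  obtain y' where y': "y' \<in> S" "dist y' y < e / 2"
    using y(1) assms(2) by (meson closure_approachable half_gt_zero)
  have "norm (x + y') \<le> norm (x + y) + norm (y' - y)"
    using norm_triangle_ineq[of "x + y" "y' - y"] by simp
  then show ?thesis using that[OF y'(1)] y(2) y'(2) by (simp add: dist_norm)
qed

lemma quotient_norm_perturb:
  assumes "Y \<noteq> {}"
  shows "quotient_norm Y x \<le> quotient_norm Y x' + norm (x - x')"
proof (rule field_le_epsilon)
  fix e :: real assume "0 < e"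
  then obtain y where y: "y \<in> Y" "norm (x' + y) < quotient_norm Y x' + e"
    using quotient_norm_approx assms by metis
  have "norm (x + y) \<le> norm (x' + y) + norm (x - x')"
    using norm_triangle_ineq[of "x' + y" "x - x'"] by (simp add: algebra_simps)
  then show "quotient_norm Y x \<le> quotient_norm Y x' + norm (x - x') + e"
    using quotient_norm_le[OF y(1), of x] y(2) by linarith
qed

lemma subspace_closure:
  fixes S :: "'a::real_normed_vector set"
  assumes "subspace S"
  shows "subspace (closure S)"
proof (rule subspaceI)
  show "0 \<in> closure S" using subspace_0[OF assms] closure_subset by blast
next
  fix x y assume "x \<in> closure S" "y \<in> closure S"
  then obtain f g where f: "\<forall>i. f i \<in> S" "f \<longlonglongrightarrow> x" and g: "\<forall>i. g i \<in> S" "g \<longlonglongrightarrow> y"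
    using closure_sequential[of x S] closure_sequential[of y S] by auto
  have "\<forall>i. f i + g i \<in> S" using f(1) g(1) subspace_add[OF assms] by simp
  moreover have "(\<lambda>i. f i + g i) \<longlonglongrightarrow> x + y" using f(2) g(2) by (rule tendsto_add)
  ultimately show "x + y \<in> closure S" unfolding closure_sequential by (intro exI conjI)
next
  fix r x assume "x \<in> closure S"
  then obtain f where f: "\<forall>i. f i \<in> S" "f \<longlonglongrightarrow> x"
    using closure_sequential[of x S] by auto
  have "\<forall>i. r *\<^sub>R f i \<in> S" using f(1) subspace_scale[OF assms] by simp
  moreover have "(\<lambda>i. r *\<^sub>R f i) \<longlonglongrightarrow> r *\<^sub>R x" using f(2) by (intro tendsto_intros)
  ultimately show "r *\<^sub>R x \<in> closure S" unfolding closure_sequential by (intro exI conjI)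
qed

section \<open>The cotype inequality in the quotient\<close>

lemma step_cotype:
  assumes \<A>: "\<A> \<subseteq> dyadic_intervals" and Y: "Y = closure (span (haar_L1 ` \<A>))" and e: "0 < e"
  shows "L2_set (\<lambda>j. quotient_norm Y (step m0 (a j))) {..<n}
    \<le> 2000000 * sign_average n (\<lambda>\<epsilon>. quotient_norm Y (\<Sum>j<n. \<epsilon> j *\<^sub>R step m0 (a j))) + e"
proof -
  define H where "H = span (haar_L1 ` \<A>)"
  define s where "s \<epsilon> = (\<Sum>j<n. \<epsilon> j *\<^sub>R step m0 (a j))" for \<epsilon>
  \<comment> \<open>Budget: \<open>2000000 * (2 * \<eta>)\<close> from the choice of the
    \<open>y \<epsilon>\<close> and \<open>2 * \<eta>\<close> from \<open>finite_cotype\<close> add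
    up to \<open>e\<close>.\<close>
  define \<eta> where "\<eta> = e / 4000002"
  have \<eta>: "0 < \<eta>" using e by (simp add: \<eta>_def)
  have "H \<noteq> {}" using span_zero unfolding H_def by blast
  then have "\<exists>y. y \<in> H \<and> norm (s \<epsilon> + y) < quotient_norm Y (s \<epsilon>) + 2 * \<eta>" for \<epsilon>
    using quotient_norm_closure_approx[of H "2 * \<eta>" "s \<epsilon>"] \<eta> unfolding Y H_def by auto
  then obtain y where y: "\<And>\<epsilon>. y \<epsilon> \<in> H" "\<And>\<epsilon>. norm (s \<epsilon> + y \<epsilon>) < quotient_norm Y (s \<epsilon>) + 2 * \<eta>"
    by metis
  have "\<forall>\<epsilon>. \<exists>m0. \<forall>m\<ge>m0. \<exists>c. (\<forall>k i. \<not> node_in \<A> k i \<longrightarrow> c k i = 0) \<and> y \<epsilon> = step m (synth m c)"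
    using span_haar_is_step[OF \<A>] y(1) unfolding H_def by blast
  then have "\<exists>M. \<forall>\<epsilon>. \<forall>m\<ge>M \<epsilon>. \<exists>c. (\<forall>k i. \<not> node_in \<A> k i \<longrightarrow> c k i = 0) \<and> y \<epsilon> = step m (synth m c)"
    by (rule choice)
  then obtain M where M: "\<And>\<epsilon> m. M \<epsilon> \<le> m \<Longrightarrow> \<exists>c. (\<forall>k i. \<not> node_in \<A> k i \<longrightarrow> c k i = 0) \<and> y \<epsilon> = step m (synth m c)"
    by blast
  define l where "l = Max (M ` sign_vectors n)"
  define m where "m = m0 + l"
  have "M \<epsilon> \<le> m" if "\<epsilon> \<in> sign_vectors n" for \<epsilon>
    using Max_ge[of "M ` sign_vectors n" "M \<epsilon>"] that finite_sign_vectors by (simp add: m_def l_def trans_le_add2)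
  \<comment> \<open>The level \<open>m\<close> is chosen for the finitely many sign vectors. For
    other \<epsilon> any coefficients with the right support will do, which is all that
    \<open>finite_cotype\<close> asks of them.\<close>
  then have "\<exists>c. (\<forall>k i. \<not> node_in \<A> k i \<longrightarrow> c k i = 0) \<and> (\<epsilon> \<in> sign_vectors n \<longrightarrow> y \<epsilon> = step m (synth m c))" for \<epsilon>
    using M by (cases "\<epsilon> \<in> sign_vectors n") auto
  then have "\<forall>\<epsilon>. \<exists>c. (\<forall>k i. \<not> node_in \<A> k i \<longrightarrow> c k i = 0) \<and> (\<epsilon> \<in> sign_vectors n \<longrightarrow> y \<epsilon> = step m (synth m c))"
    by blast
  then have "\<exists>c. \<forall>\<epsilon>. (\<forall>k i. \<not> node_in \<A> k i \<longrightarrow> c \<epsilon> k i = 0) \<and> (\<epsilon> \<in> sign_vectors n \<longrightarrow> y \<epsilon> = step m (synth m (c \<epsilon>)))"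
    by (rule choice)
  then obtain c where c: "\<And>\<epsilon> k i. \<not> node_in \<A> k i \<Longrightarrow> c \<epsilon> k i = 0"
    "\<And>\<epsilon>. \<epsilon> \<in> sign_vectors n \<Longrightarrow> y \<epsilon> = step m (synth m (c \<epsilon>))"
    by blast
  define x where "x j p = a j (p div 2^l)" for j p
  have x: "step m0 (a j) = step m (x j)" for j
    unfolding m_def x_def by (rule step_refine[symmetric])
  obtain b where b: "\<And>j k i. \<not> node_in \<A> k i \<Longrightarrow> b j k i = 0"
    "L2_set (\<lambda>j. mean m (\<lambda>p. \<bar>x j p + synth m (b j) p\<bar>)) {..<n}
      \<le> 2000000 * sign_average n (\<lambda>\<epsilon>. mean m (\<lambda>p. \<bar>(\<Sum>j<n. \<epsilon> j * x j p) + synth m (c \<epsilon>) p\<bar>)) + 2 * \<eta>"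
    using finite_cotype[of "node_in \<A>" c \<eta> m x n] c(1) \<eta> by blast
  have "L2_set (\<lambda>j. quotient_norm Y (step m0 (a j))) {..<n} \<le> L2_set (\<lambda>j. mean m (\<lambda>p. \<bar>x j p + synth m (b j) p\<bar>)) {..<n}"
  proof (rule L2_set_mono)
    fix j
    have "step m (synth m (b j)) \<in> H"
      unfolding H_def by (rule step_synth_in_span) (rule b(1))
    then have "step m (synth m (b j)) \<in> Y" unfolding Y H_def using closure_subset by blast
    then have "quotient_norm Y (step m0 (a j)) \<le> norm (step m (x j) + step m (synth m (b j)))"
      unfolding x by (rule quotient_norm_le)
    then show "quotient_norm Y (step m0 (a j)) \<le> mean m (\<lambda>p. \<bar>x j p + synth m (b j) p\<bar>)"
      by (simp add: norm_step flip: step_add)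
    have "Y \<noteq> {}" using \<open>H \<noteq> {}\<close> unfolding Y H_def by simp
    then show "0 \<le> quotient_norm Y (step m0 (a j))" by (rule quotient_norm_nonneg)
  qed
  also note b(2)
  also have "sign_average n (\<lambda>\<epsilon>. mean m (\<lambda>p. \<bar>(\<Sum>j<n. \<epsilon> j * x j p) + synth m (c \<epsilon>) p\<bar>))
      \<le> sign_average n (\<lambda>\<epsilon>. quotient_norm Y (s \<epsilon>) + 2 * \<eta>)"
  proof (rule sign_average_mono)
    fix \<epsilon> assume \<epsilon>: "\<epsilon> \<in> sign_vectors n"
    have "s \<epsilon> + y \<epsilon> = step m (\<lambda>p. (\<Sum>j<n. \<epsilon> j * x j p) + synth m (c \<epsilon>) p)"
      by (simp add: s_def x c(2)[OF \<epsilon>] step_add step_sum step_scaleR)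
    then show "mean m (\<lambda>p. \<bar>(\<Sum>j<n. \<epsilon> j * x j p) + synth m (c \<epsilon>) p\<bar>) \<le> quotient_norm Y (s \<epsilon>) + 2 * \<eta>"
      using y(2)[of \<epsilon>] by (simp add: norm_step)
  qed
  also have "\<dots> = sign_average n (\<lambda>\<epsilon>. quotient_norm Y (s \<epsilon>)) + 2 * \<eta>"
    by (simp add: sign_average_add sign_average_const)
  finally show ?thesis by (simp add: s_def \<eta>_def)
qed

lemma quotient_cotype:
  assumes \<A>: "\<A> \<subseteq> dyadic_intervals" and Y: "Y = closure (span (haar_L1 ` \<A>))"
  shows "L2_set (\<lambda>j. quotient_norm Y (x j)) {..<n}
    \<le> 2000000 * sign_average n (\<lambda>\<epsilon>. quotient_norm Y (\<Sum>j<n. \<epsilon> j *\<^sub>R x j))"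
proof (rule field_le_epsilon)
  fix e :: real assume e: "0 < e"
  have Y0: "Y \<noteq> {}" using span_zero unfolding Y by fastforce
  \<comment> \<open>Multiples of \<delta> to be absorbed: \<open>n\<close> on the left side,
    \<open>2000000 * n\<close> inside the sign average, and 1 from
    \<open>step_cotype\<close>.\<close>
  define K where "K = 2 + 2000001 * real n"
  define \<delta> where "\<delta> = e / K"
  have K: "0 < K" by (simp add: K_def)
  have \<delta>: "0 < \<delta>" "\<delta> * K = e" using e K by (auto simp: \<delta>_def)
  have "\<exists>m a. norm (x j - step m a) < \<delta>" for j by (rule step_dense[OF \<delta>(1)])
  then obtain m a where ma: "\<And>j. norm (x j - step (m j) (a j)) < \<delta>" by metis
  define L where "L = (\<Sum>j<n. m j)"
  have "\<exists>b. step (m j) (a j) = step L b" if "j < n" for j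
  proof -
    have "m j \<le> L" unfolding L_def using that by (intro member_le_sum) auto
    then have "L = m j + (L - m j)" by simp
    then show ?thesis using step_refine[of "m j" "L - m j" "a j"] by metis
  qed
  then obtain b where b: "\<And>j. j < n \<Longrightarrow> step (m j) (a j) = step L (b j)" by metis
  have close: "norm (x j - step L (b j)) \<le> \<delta>" if "j < n" for j
    using ma[of j] b[OF that] by simp
  have "L2_set (\<lambda>j. quotient_norm Y (x j)) {..<n} \<le> L2_set (\<lambda>j. quotient_norm Y (step L (b j)) + \<delta>) {..<n}"
  proof (rule L2_set_mono)
    fix j assume "j \<in> {..<n}"
    then show "quotient_norm Y (x j) \<le> quotient_norm Y (step L (b j)) + \<delta>"
      using quotient_norm_perturb[OF Y0, of "x j" "step L (b j)"] close[of j] by simp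
  qed (rule quotient_norm_nonneg[OF Y0])
  also have "\<dots> \<le> L2_set (\<lambda>j. quotient_norm Y (step L (b j))) {..<n} + L2_set (\<lambda>j. \<delta>) {..<n}"
    by (rule L2_set_triangle_ineq)
  also have "L2_set (\<lambda>j. \<delta>) {..<n} \<le> real n * \<delta>"
    using L2_set_le_sum[of "{..<n}" "\<lambda>j. \<delta>"] \<delta> by simp
  also have "L2_set (\<lambda>j. quotient_norm Y (step L (b j))) {..<n}
    \<le> 2000000 * sign_average n (\<lambda>\<epsilon>. quotient_norm Y (\<Sum>j<n. \<epsilon> j *\<^sub>R step L (b j))) + \<delta>"
    by (rule step_cotype[OF \<A> Y \<delta>(1)])
  also have "sign_average n (\<lambda>\<epsilon>. quotient_norm Y (\<Sum>j<n. \<epsilon> j *\<^sub>R step L (b j)))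
    \<le> sign_average n (\<lambda>\<epsilon>. quotient_norm Y (\<Sum>j<n. \<epsilon> j *\<^sub>R x j) + real n * \<delta>)"
  proof (rule sign_average_mono)
    fix \<epsilon> assume \<epsilon>: "\<epsilon> \<in> sign_vectors n"
    have "norm ((\<Sum>j<n. \<epsilon> j *\<^sub>R step L (b j)) - (\<Sum>j<n. \<epsilon> j *\<^sub>R x j)) = norm (\<Sum>j<n. \<epsilon> j *\<^sub>R (step L (b j) - x j))"
      by (simp add: scaleR_diff_right sum_subtractf)
    also have "\<dots> \<le> (\<Sum>j<n. \<delta>)"
    proof (rule sum_norm_le)
      fix j assume j: "j \<in> {..<n}"
      have "\<epsilon> j \<in> {-1, 1}" using \<epsilon> j unfolding sign_vectors_def by (rule PiE_mem)
      then have "\<bar>\<epsilon> j\<bar> = 1" by auto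
      then show "norm (\<epsilon> j *\<^sub>R (step L (b j) - x j)) \<le> \<delta>"
        using close[of j] j by (simp add: norm_minus_commute)
    qed
    finally show "quotient_norm Y (\<Sum>j<n. \<epsilon> j *\<^sub>R step L (b j)) \<le> quotient_norm Y (\<Sum>j<n. \<epsilon> j *\<^sub>R x j) + real n * \<delta>"
      using quotient_norm_perturb[OF Y0, of "\<Sum>j<n. \<epsilon> j *\<^sub>R step L (b j)" "\<Sum>j<n. \<epsilon> j *\<^sub>R x j"] by simp
  qed
  also have "\<dots> = sign_average n (\<lambda>\<epsilon>. quotient_norm Y (\<Sum>j<n. \<epsilon> j *\<^sub>R x j)) + real n * \<delta>"
    by (simp add: sign_average_add sign_average_const)
  finally have "L2_set (\<lambda>j. quotient_norm Y (x j)) {..<n}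
    \<le> 2000000 * sign_average n (\<lambda>\<epsilon>. quotient_norm Y (\<Sum>j<n. \<epsilon> j *\<^sub>R x j)) + (\<delta> + 2000001 * real n * \<delta>)"
    by (simp add: algebra_simps)
  also have "\<delta> + 2000001 * real n * \<delta> \<le> e"
    using \<delta> unfolding K_def by (simp add: algebra_simps)
  finally show "L2_set (\<lambda>j. quotient_norm Y (x j)) {..<n}
    \<le> 2000000 * sign_average n (\<lambda>\<epsilon>. quotient_norm Y (\<Sum>j<n. \<epsilon> j *\<^sub>R x j)) + e"
    by simp
qed

theorem theorem1:
  fixes \<A> :: "real set set" and Y :: "L1 set"
  assumes "\<A> \<subseteq> dyadic_intervals"
    and "Y = closure (span (haar_L1 ` \<A>))"
  shows "cotype_2 (quotient_space Y)"
proof -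
  have Y: "subspace Y" unfolding assms(2) by (rule subspace_closure[OF subspace_span])
  note ops = quotient_space_ops[OF Y]
  have nssum: "nssum (quotient_space Y) (\<lambda>j. nsscale (quotient_space Y) (\<epsilon> j) (x j +o Y)) n = (\<Sum>j<n. \<epsilon> j *\<^sub>R x j) +o Y"
    for n \<epsilon> and x :: "nat \<Rightarrow> L1"
  proof (induction n)
    case 0
    show ?case by (simp add: quotient_space_def)
  next
    case (Suc n)
    then show ?case by (simp add: ops)
  qed
  have "sqrt (\<Sum>j<n. (nsnorm (quotient_space Y) (X j))\<^sup>2)
      \<le> 2000000 * ((\<Sum>\<epsilon>\<in>sign_vectors n. nsnorm (quotient_space Y) (nssum (quotient_space Y) (\<lambda>j. nsscale (quotient_space Y) (\<epsilon> j) (X j)) n))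
                / real (card (sign_vectors n)))"
    if X: "\<forall>j<n. X j \<in> nscarrier (quotient_space Y)" for n X
  proof -
    have "\<forall>j<n. \<exists>x. X j = x +o Y" using X by (auto simp: quotient_space_def)
    then obtain x where x: "\<And>j. j < n \<Longrightarrow> X j = x j +o Y" by metis
    \<comment> \<open>Representatives are known only below \<open>n\<close>, so the induction on
      partial sums must stop at \<open>n\<close>.\<close>
    have "nssum (quotient_space Y) (\<lambda>j. nsscale (quotient_space Y) (\<epsilon> j) (X j)) k
        = nssum (quotient_space Y) (\<lambda>j. nsscale (quotient_space Y) (\<epsilon> j) (x j +o Y)) k" if "k \<le> n" for k \<epsilon>
      using that by (induction k) (simp_all add: x)
    then have "nsnorm (quotient_space Y) (nssum (quotient_space Y) (\<lambda>j. nsscale (quotient_space Y) (\<epsilon> j) (X j)) n)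
        = quotient_norm Y (\<Sum>j<n. \<epsilon> j *\<^sub>R x j)" for \<epsilon>
      by (simp add: nssum ops(3) quotient_norm_def)
    moreover have "nsnorm (quotient_space Y) (X j) = quotient_norm Y (x j)" if "j < n" for j
      using that by (simp add: x ops(3) quotient_norm_def)
    ultimately show ?thesis
      using quotient_cotype[OF assms, of x n] by (simp add: L2_set_def sign_average_def)
  qed
  then show ?thesis unfolding cotype_2_def by blast
qed

end
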